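(* Let $\tau_1, \ldots, \tau_d, \tau_{d+1}, \ldots, \tau_r, \tau_{r+1}, \ldots, \tau_s$ be pairwise incomparable types (rational groups), $d \geq 1$, $r \geq d$, $s \geq r$, let $$A_1 = \tau_1 v_1 \oplus \cdots \oplus \tau_d v_d \oplus \tau_{d+1} v_{d+1} \oplus \cdots \oplus \tau_r v_r,$$ $$A_2 = \tau_1 w_1 \oplus \cdots \oplus \tau_d w_d \oplus \tau_{r+1} v_{r+1} \oplus \cdots \oplus \tau_s v_s,$$ and $$X_1 = A_1 + \frac{\mathbb{Z}}{e_1}(\alpha_1 v_1 + \cdots + \alpha_d v_d + \alpha_{d+1} v_{d+1} + \cdots + \alpha_r v_r),$$ $$X_2 = A_2 + \frac{\mathbb{Z}}{e_2}(\beta_1 w_1 + \cdots + \beta_d w_d + \beta_{r+1} v_{r+1} + \cdots + \beta_s v_s),$$ where $\alpha_i, \beta_j \in \mathbb{Z}$, each $\alpha_i$ divides $e_1$, each $\beta_j$ divides $e_2$, $A_i = R(X_i)$ for $i=1,2$, and $e_1, e_2$ are relatively prime positive integers. For $i = 1, \ldots, d$, let $f_i = \gcd(e_2 \alpha_i, e_1 \beta_i)$. Then there exists a decomposition basis $\{v_1', w_1', \ldots, v_d', w_d', v_{d+1}, \ldots, v_r, v_{r+1}, \ldots, v_s\}$ of $A_1 \oplus A_2 = R(X_1 \oplus X_2)$ such that with $$A = \tau_1 v_1' \oplus \cdots \oplus \tau_d v_d' \oplus \tau_{d+1} v_{d+1} \oplus \cdots \oplus \tau_s v_s$$ we have $X_1\oplus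 X_2 = Y \oplus \tau_1 w_1' \oplus \cdots \oplus \tau_d w_d'$, where $$Y = A + \frac{\mathbb{Z}}{e_1 e_2}\left(\sum_{i=1}^d f_i v_i' + \sum_{i=d+1}^r e_2 \alpha_i v_i + \sum_{i=r+1}^s e_1 \beta_i v_i \right).$$ Furthermore, if $X_1$ and $X_2$ are both indecomposable, then so is $Y$. All generator coefficients of $Y$ (the integers $f_i$, $e_2\alpha_i$, $e_1\beta_i$ occurring in the displayed formula for $Y$) are divisors of $e_1 e_2$. In passing from the decomposition $X_1 \oplus X_2$ to $Y \oplus \tau_1 w_1' \oplus \cdots \oplus \tau_d w_d'$ the number of summands does not decrease.
   Context: All groups are torsion-free abelian of finite rank. Types are isomorphism classes of rank-one groups, with $\sigma\le\tau$ iff there is a nonzero homomorphism from a group of type $\sigma$ to one of type $\tau$. A rational group is an additive subgroup of $\mathbb{Q}$ containing $1$; the same symbol $\tau$ denotes a rational group and its type. A completely decomposable group is a direct sum of rank-one groups; written as $A=\bigoplus_{i=1}^n \tau_i v_i$ with rank-one summands $\tau_iv_i$, $v_i\neq 0$, and rational groups $\tau_i=\{x\in\mathbb{Q}\mid xv_i\in A\}$, the set $\{v_1,\dots,v_n\}$ is called a decomposition basis of $A$. An almost completely decomposable group is a group $X$ containing a completely decomposable subgroup of finite index; the completely decomposable subgroups of least index in $X$ are its regulating subgroups, and the regulator $R(X)$ is the intersection of all of them (a completely decomposable, fully invariant subgroup of finite index in $X$). The notation $A+\frac{\mathbb{Z}}{e}a$ means the subgroup $A+\mathbb{Z}e^{-1}a$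 of the divisible hull $\mathbb{Q}A$. *)

theory Defs
  imports Complex_Main "HOL-Library.Set_Algebras"
begin

text \<open>
  Torsion-free abelian groups of finite rank are rendered as additive subgroups of an arbitrary
  rational vector space with scalar multiplication \<open>scale\<close>; the divisible hull of such a group is
  its linear span, and its rank is the dimension of that span.  The sum \<open>A + B\<close> of two sets is the
  elementwise sum.
\<close>

definition add_subgroup :: "'v::ab_group_add set \<Rightarrow> bool" where
  "add_subgroup G \<longleftrightarrow> 0 \<in> G \<and> (\<forall>x\<in>G. \<forall>y\<in>G. x + y \<in> G) \<and> (\<forall>x\<in>G. - x \<in> G)"

definition internal_direct_sum ::
  "'v::ab_group_add set \<Rightarrow> 'i set \<Rightarrow> ('i \<Rightarrow> 'v set) \<Rightarrow> bool" where
  "internal_direct_sum X I G \<longleftrightarrow>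
     finite I \<and> (\<forall>i\<in>I. add_subgroup (G i)) \<and> X = (\<Sum>i\<in>I. G i) \<and>
     (\<forall>g. (\<forall>i\<in>I. g i \<in> G i) \<and> (\<Sum>i\<in>I. g i) = 0 \<longrightarrow> (\<forall>i\<in>I. g i = 0))"

definition indecomposable :: "'v::ab_group_add set \<Rightarrow> bool" where
  "indecomposable X \<longleftrightarrow> X \<noteq> {0} \<and>
     (\<forall>B C. add_subgroup B \<and> add_subgroup C \<and> B \<inter> C = {0} \<and> X = B + C \<longrightarrow>
        B = {0} \<or> C = {0})"

definition rational_group :: "rat set \<Rightarrow> bool" where
  "rational_group T \<longleftrightarrow> add_subgroup T \<and> 1 \<in> T"

definition type_le :: "rat set \<Rightarrow> rat set \<Rightarrow> bool" where
  "type_le S T \<longleftrightarrow>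
     (\<exists>h :: rat \<Rightarrow> rat. (\<forall>x\<in>S. h x \<in> T) \<and> (\<forall>x\<in>S. \<forall>y\<in>S. h (x + y) = h x + h y) \<and>
        (\<exists>x\<in>S. h x \<noteq> 0))"

text \<open>The group \<open>\<tau>v\<close> for a rational group \<open>\<tau>\<close> and a vector \<open>v\<close>.\<close>

definition rat_multiples ::
  "(rat \<Rightarrow> 'v::ab_group_add \<Rightarrow> 'v) \<Rightarrow> rat set \<Rightarrow> 'v \<Rightarrow> 'v set" where
  "rat_multiples scale T v = (\<lambda>x. scale x v) ` T"

text \<open>The group \<open>\<int>e\<^sup>-\<^sup>1a\<close>.\<close>

definition int_multiples_over ::
  "(rat \<Rightarrow> 'v::ab_group_add \<Rightarrow> 'v) \<Rightarrow> int \<Rightarrow> 'v \<Rightarrow> 'v set" where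
  "int_multiples_over scale e a = range (\<lambda>k::int. scale (of_int k / of_int e) a)"

definition rank_one :: "(rat \<Rightarrow> 'v::ab_group_add \<Rightarrow> 'v) \<Rightarrow> 'v set \<Rightarrow> bool" where
  "rank_one scale G \<longleftrightarrow> add_subgroup G \<and> vector_space.dim scale G = 1"

definition completely_decomposable ::
  "(rat \<Rightarrow> 'v::ab_group_add \<Rightarrow> 'v) \<Rightarrow> 'v set \<Rightarrow> bool" where
  "completely_decomposable scale A \<longleftrightarrow>
     (\<exists>(n::nat) G. internal_direct_sum A {..<n} G \<and> (\<forall>i<n. rank_one scale (G i)))"

definition decomposition_basis ::
  "(rat \<Rightarrow> 'v::ab_group_add \<Rightarrow> 'v) \<Rightarrow> 'v set \<Rightarrow> 'v set \<Rightarrow> bool" where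
  "decomposition_basis scale A B \<longleftrightarrow>
     (\<forall>b\<in>B. b \<noteq> 0 \<and> rational_group {x. scale x b \<in> A}) \<and>
     internal_direct_sum A B (\<lambda>b. rat_multiples scale {x. scale x b \<in> A} b)"

definition cosets :: "'v::ab_group_add set \<Rightarrow> 'v set \<Rightarrow> 'v set set" where
  "cosets X A = (\<lambda>x. x +o A) ` X"

definition finite_index_cd_subgroup ::
  "(rat \<Rightarrow> 'v::ab_group_add \<Rightarrow> 'v) \<Rightarrow> 'v set \<Rightarrow> 'v set \<Rightarrow> bool" where
  "finite_index_cd_subgroup scale X A \<longleftrightarrow>
     completely_decomposable scale A \<and> A \<subseteq> X \<and> finite (cosets X A)"

definition regulating_subgroup ::
  "(rat \<Rightarrow> 'v::ab_group_add \<Rightarrow> 'v) \<Rightarrow> 'v set \<Rightarrow> 'v set \<Rightarrow> bool" where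
  "regulating_subgroup scale X A \<longleftrightarrow> finite_index_cd_subgroup scale X A \<and>
     (\<forall>B. finite_index_cd_subgroup scale X B \<longrightarrow> card (cosets X A) \<le> card (cosets X B))"

definition regulator :: "(rat \<Rightarrow> 'v::ab_group_add \<Rightarrow> 'v) \<Rightarrow> 'v set \<Rightarrow> 'v set" where
  "regulator scale X = \<Inter> {A. regulating_subgroup scale X A}"

end

theory Submission imports Defs begin

text \<open>
  Since the types are pairwise incomparable, a homomorphism between homogeneous summands of different
  types vanishes.  Composing the projections of a completely decomposable subgroup of finite index
  with multiplication by its index yields endomorphisms, so every rank-one summand lies in a single
  homogeneous block; hence the regulator is the sum of the purifications of the blocks, and it is
  additive on \<open>X\<^sub>1 \<oplus> X\<^sub>2\<close>.

  As \<open>e\<^sub>1\<close> and \<open>e\<^sub>2\<close> are coprime, \<open>X\<^sub>1 \<oplus> X\<^sub>2\<close> is generated over \<open>A\<^sub>1 \<oplus> A\<^sub>2\<close> by the single element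
  \<open>(e\<^sub>2a\<^sub>1 + e\<^sub>1a\<^sub>2) / (e\<^sub>1e\<^sub>2)\<close>.  In the block of \<open>\<tau>\<^sub>i\<close>, \<open>i \<le> d\<close>, the vector \<open>e\<^sub>2\<alpha>\<^sub>iv\<^sub>i + e\<^sub>1\<beta>\<^sub>iw\<^sub>i\<close> is \<open>f\<^sub>i\<close> times a
  primitive vector \<open>v'\<^sub>i\<close>, which a unimodular matrix completes to a basis \<open>v'\<^sub>i, w'\<^sub>i\<close>; the \<open>w'\<^sub>i\<close> split off.

  A decomposition of \<open>Y\<close> is given by a partition of the types.  The corresponding projection onto
  blocks preserves \<open>Y\<close>, hence \<open>X\<^sub>1 \<oplus> X\<^sub>2\<close>, hence \<open>X\<^sub>1\<close> and \<open>X\<^sub>2\<close>; if these are indecomposable, the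
  common type \<open>\<tau>\<^sub>1\<close> forces one part of the partition to be empty.
\<close>

section \<open>Subgroups, cosets and direct sums\<close>

lemma add_subgroup_zero: "add_subgroup G \<Longrightarrow> 0 \<in> G"
  and add_subgroup_add: "add_subgroup G \<Longrightarrow> x \<in> G \<Longrightarrow> y \<in> G \<Longrightarrow> x + y \<in> G"
  and add_subgroup_uminus: "add_subgroup G \<Longrightarrow> x \<in> G \<Longrightarrow> - x \<in> G"
  by (auto simp: add_subgroup_def)

lemma add_subgroup_diff: "add_subgroup G \<Longrightarrow> x \<in> G \<Longrightarrow> y \<in> G \<Longrightarrow> x - y \<in> G"
  using add_subgroup_add[of G x "- y"] add_subgroup_uminus[of G y] by simp

lemma add_subgroup_sum:
  "add_subgroup G \<Longrightarrow> (\<And>i. i \<in> I \<Longrightarrow> g i \<in> G) \<Longrightarrow> (\<Sum>i\<in>I. g i) \<in> G"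
  by (induction I rule: infinite_finite_induct)
    (auto intro: add_subgroup_zero add_subgroup_add)

lemma add_subgroup_plus:
  assumes "add_subgroup G" "add_subgroup H"
  shows "add_subgroup (G + H)"
  unfolding add_subgroup_def
proof (intro conjI ballI)
  show "0 \<in> G + H"
    using set_plus_intro[of 0 G 0 H] assms by (simp add: add_subgroup_zero)
next
  fix x y assume "x \<in> G + H" "y \<in> G + H"
  then obtain a b a' b' where "x = a + b" "y = a' + b'" "a \<in> G" "b \<in> H" "a' \<in> G" "b' \<in> H"
    by (auto elim!: set_plus_elim)
  moreover from this have "x + y = (a + a') + (b + b')" by (simp add: algebra_simps)
  ultimately show "x + y \<in> G + H"
    using assms by (metis add_subgroup_add set_plus_intro)
next
  fix x assume "x \<in> G + H"
  then obtain a b where "x = a + b" "a \<in> G" "b \<in> H" by (auto elim!: set_plus_elim)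
  moreover from this have "- x = - a + - b" by simp
  ultimately show "- x \<in> G + H"
    using assms by (metis add_subgroup_uminus set_plus_intro)
qed

lemma add_subgroup_set_sum:
  "finite I \<Longrightarrow> (\<And>i. i \<in> I \<Longrightarrow> add_subgroup (G i)) \<Longrightarrow> add_subgroup (\<Sum>i\<in>I. G i)"
  by (induction I rule: finite_induct) (auto intro: add_subgroup_plus, simp add: add_subgroup_def)

lemma internal_direct_sum_subgroup: "internal_direct_sum X I G \<Longrightarrow> add_subgroup X"
  by (auto simp: internal_direct_sum_def intro: add_subgroup_set_sum)

lemma internal_direct_sum_reindex:
  assumes "inj_on f J"
  shows "internal_direct_sum X (f ` J) G \<longleftrightarrow> internal_direct_sum X J (G \<circ> f)"
proof -
  have fin: "finite (f ` J) \<longleftrightarrow> finite J"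
    using assms by (rule finite_image_iff)
  have "(\<forall>g. (\<forall>i\<in>f ` J. g i \<in> G i) \<and> sum g (f ` J) = 0 \<longrightarrow> (\<forall>i\<in>f ` J. g i = 0)) \<longleftrightarrow>
        (\<forall>g. (\<forall>j\<in>J. g j \<in> (G \<circ> f) j) \<and> sum g J = 0 \<longrightarrow> (\<forall>j\<in>J. g j = 0))" (is "?l \<longleftrightarrow> ?r")
  proof
    assume l: ?l
    show ?r
    proof (intro allI impI)
      fix g assume g: "(\<forall>j\<in>J. g j \<in> (G \<circ> f) j) \<and> sum g J = 0"
      \<comment> \<open>The inverse of \<open>f\<close> on \<open>J\<close> turns a family over
        \<open>J\<close> into one over its image, to which \<open>l\<close> applies.\<close>
      define g' where "g' = g \<circ> the_inv_into J f"
      have g': "g' (f j) = g j" if "j \<in> J" for j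
        using that assms by (simp add: g'_def the_inv_into_f_f)
      have "sum g' (f ` J) = 0" using g g' by (simp add: sum.reindex[OF assms] cong: sum.cong)
      moreover have "\<forall>i\<in>f ` J. g' i \<in> G i" using g g' by auto
      ultimately show "\<forall>j\<in>J. g j = 0" using l g' by (metis imageI)
    qed
  next
    assume r: ?r
    show ?l
    proof (intro allI impI)
      fix g assume g: "(\<forall>i\<in>f ` J. g i \<in> G i) \<and> sum g (f ` J) = 0"
      then have "\<forall>j\<in>J. (g \<circ> f) j = 0"
        using r[rule_format, of "g \<circ> f"] by (auto simp: sum.reindex[OF assms])
      then show "\<forall>i\<in>f ` J. g i = 0" by auto
    qed
  qed
  then show ?thesis
    unfolding internal_direct_sum_def fin by (auto simp: sum.reindex[OF assms])
qed

text \<open>Components are chosen for members of \<open>X\<close> only, so additivity is claimed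
  there alone; it comes from uniqueness of the expansion.\<close>

lemma internal_direct_sum_projections:
  assumes "internal_direct_sum X I G"
  obtains p where "\<And>i x. i \<in> I \<Longrightarrow> x \<in> X \<Longrightarrow> p i x \<in> G i"
    and "\<And>x. x \<in> X \<Longrightarrow> (\<Sum>i\<in>I. p i x) = x"
    and "\<And>i x y. i \<in> I \<Longrightarrow> x \<in> X \<Longrightarrow> y \<in> X \<Longrightarrow> p i (x + y) = p i x + p i y"
    and "\<And>i x. i \<in> I \<Longrightarrow> x \<in> G i \<Longrightarrow> p i x = x"
proof -
  have fin: "finite I" and X: "X = {sum s I |s. \<forall>i\<in>I. s i \<in> G i}"
    and G: "\<And>i. i \<in> I \<Longrightarrow> add_subgroup (G i)"
    and zero: "\<And>g i. (\<And>i. i \<in> I \<Longrightarrow> g i \<in> G i) \<Longrightarrow> sum g I = 0 \<Longrightarrow> i \<in> I \<Longrightarrow> g i = 0"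
    using assms by (auto simp: internal_direct_sum_def set_sum_alt)
  have uniq: "g i = h i" if "\<And>i. i \<in> I \<Longrightarrow> g i \<in> G i" "\<And>i. i \<in> I \<Longrightarrow> h i \<in> G i"
    "sum g I = sum h I" "i \<in> I" for g h i
    using zero[of "\<lambda>i. g i - h i" i] that add_subgroup_diff[OF G]
    by (simp add: sum_subtractf)
  have "\<forall>x\<in>X. \<exists>q. (\<forall>i\<in>I. q i \<in> G i) \<and> sum q I = x"
    using X by auto
  then obtain q where q: "\<And>x i. x \<in> X \<Longrightarrow> i \<in> I \<Longrightarrow> q x i \<in> G i"
    "\<And>x. x \<in> X \<Longrightarrow> sum (q x) I = x"
    by metis
  have X_sub: "add_subgroup X" using assms by (rule internal_direct_sum_subgroup)
  show ?thesis
  proof (rule that[of "\<lambda>i x. q x i"])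
    fix i x y assume "i \<in> I" "x \<in> X" "y \<in> X"
    then show "q (x + y) i = q x i + q y i"
      using uniq[of "q (x + y)" "\<lambda>i. q x i + q y i" i] q add_subgroup_add[OF X_sub]
        add_subgroup_add[OF G] by (simp add: sum.distrib)
  next
    fix i x assume i: "i \<in> I" and x: "x \<in> G i"
    let ?g = "\<lambda>j. if j = i then x else 0"
    have mem: "\<And>j. j \<in> I \<Longrightarrow> ?g j \<in> G j" using x G add_subgroup_zero by auto
    moreover have sum: "sum ?g I = x" using i fin by simp
    ultimately have "x \<in> X" unfolding X by (intro CollectI exI[of _ ?g]) auto
    then show "q x i = x" using uniq[of "q x" ?g i] mem q sum i by auto
  qed (use q in auto)
qed

section \<open>Cosets of nested subgroups\<close>

lemma coset_eq_iff:
  assumes "add_subgroup B"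
  shows "x +o B = y +o B \<longleftrightarrow> x - y \<in> B"
proof
  assume "x +o B = y +o B"
  then have "x \<in> y +o B"
    using assms set_plus_intro2[of 0 B x] by (simp add: add_subgroup_zero)
  then show "x - y \<in> B" by (rule set_plus_imp_minus)
next
  assume d: "x - y \<in> B"
  have "x +o B = y +o ((x - y) +o B)" by (simp add: set_plus_rearrange2)
  also have "(x - y) +o B = B"
  proof (intro equalityI subsetI)
    fix z assume "z \<in> (x - y) +o B"
    then show "z \<in> B" using d assms by (metis add_subgroup_add diff_add_cancel add.commute set_plus_imp_minus)
  next
    fix z assume "z \<in> B"
    then have "z - (x - y) \<in> B" using add_subgroup_diff[OF assms _ d] by simp
    then show "z \<in> (x - y) +o B" by (rule set_minus_imp_plus)
  qed
  finally show "x +o B = y +o B" .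
qed

lemma coset_plus_supergroup:
  assumes "add_subgroup B" "add_subgroup C" "B \<subseteq> C"
  shows "(x +o B) + C = x +o C"
proof -
  have "B + C = C"
    using assms set_zero_plus2[OF add_subgroup_zero, of B C] by (fastforce elim!: set_plus_elim intro: add_subgroup_add)
  then show ?thesis by (simp add: set_plus_rearrange3)
qed

text \<open>Serves to compare indices: the cosets of the smaller subgroup map onto those of the
  larger one.\<close>

lemma cosets_supergroup:
  assumes "add_subgroup B" "add_subgroup C" "B \<subseteq> C"
  shows "cosets X C = (\<lambda>K. K + C) ` cosets X B"
  using assms by (simp add: cosets_def image_image coset_plus_supergroup)

section \<open>Integer multiples, additive maps and finite index\<close>

lemma (in vector_space) subgroup_int_multiple:
  assumes "add_subgroup G" "x \<in> G"
  shows "scale (of_int k) x \<in> G"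
proof -
  have nat: "scale (of_nat n) x \<in> G" for n
    by (induction n) (use assms in \<open>auto simp: scale_left_distrib intro: add_subgroup_zero add_subgroup_add\<close>)
  show ?thesis
  proof (cases k rule: int_cases)
    case (neg n)
    then have "scale (of_int k) x = - scale (of_nat (Suc n)) x"
      by (simp del: of_nat_Suc)
    with nat assms show ?thesis by (simp only: add_subgroup_uminus)
  qed (use nat in auto)
qed

lemma additive_on_subgroup_zero:
  assumes "add_subgroup G" "\<And>x y. x \<in> G \<Longrightarrow> y \<in> G \<Longrightarrow> h (x + y) = h x + (h y::'b::ab_group_add)"
  shows "h 0 = 0"
  using assms(2)[of 0 0] assms(1) by (simp add: add_subgroup_zero)

text \<open>\<open>h\<close> is additive on \<open>G\<close> only and need not be linear on the
  whole space; natural multipliers go by induction, negative ones by negation.\<close>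

lemma (in vector_space) additive_on_subgroup_int_multiple:
  assumes G: "add_subgroup G" and x: "x \<in> G"
    and add: "\<And>x y. x \<in> G \<Longrightarrow> y \<in> G \<Longrightarrow> h (x + y) = h x + h y"
  shows "h (scale (of_int k) x) = scale (of_int k) (h x)"
proof -
  have zero: "h 0 = 0" by (rule additive_on_subgroup_zero[OF G add])
  have uminus: "h (- y) = - h y" if "y \<in> G" for y
    using add[of y "- y"] that G zero
    by (simp add: add_subgroup_uminus eq_neg_iff_add_eq_0 add.commute)
  have mem: "scale (of_nat n) x \<in> G" for n
    using subgroup_int_multiple[OF G x, of "int n"] by simp
  have nat: "h (scale (of_nat n) x) = scale (of_nat n) (h x)" for n
    by (induction n) (use zero add mem x in \<open>auto simp: scale_left_distrib\<close>)
  show ?thesis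
  proof (cases k rule: int_cases)
    case (neg n)
    then have "scale (of_int k) y = - scale (of_nat (Suc n)) y" for y
      by (simp del: of_nat_Suc)
    with nat uminus mem show ?thesis by (simp only:)
  qed (use nat in auto)
qed

lemma additive_on_subgroup_sum:
  assumes G: "add_subgroup G"
    and add: "\<And>x y. x \<in> G \<Longrightarrow> y \<in> G \<Longrightarrow> h (x + y) = h x + (h y::'b::ab_group_add)"
    and "finite S" and "\<And>i. i \<in> S \<Longrightarrow> g i \<in> G"
  shows "h (\<Sum>i\<in>S. g i) = (\<Sum>i\<in>S. h (g i))"
  using assms(3,4)
  by (induction S rule: finite_induct)
    (auto simp: additive_on_subgroup_zero[OF G add] add add_subgroup_sum[OF G])

text \<open>Pigeonhole: with \<open>m\<close> the index, two of the multiples of \<open>x\<close> by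
  \<open>0, ..., m\<close> share a coset, so some positive number at most \<open>m\<close> carries
  \<open>x\<close> into \<open>B\<close>. The factorial of \<open>m\<close> is a multiple of every
  such number, which gives one exponent for all \<open>x\<close>.\<close>

lemma (in vector_space) finite_index_exponent:
  assumes X: "add_subgroup X" and B: "add_subgroup B" and fin: "finite (cosets X B)"
  obtains n :: int where "n > 0" and "\<And>x. x \<in> X \<Longrightarrow> scale (of_int n) x \<in> B"
proof
  let ?m = "card (cosets X B)"
  show "fact ?m > (0::int)" by simp
  fix x assume x: "x \<in> X"
  let ?f = "\<lambda>k::nat. scale (of_nat k) x +o B"
  have mem: "scale (of_nat k) x \<in> X" for k
    using subgroup_int_multiple[OF X x, of "int k"] by simp
  have "?f ` {0..?m} \<subseteq> cosets X B"
    using mem by (auto simp: cosets_def)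
  then have "card (?f ` {0..?m}) < card {0..?m}"
    using card_mono[OF fin] by (metis card_atLeastAtMost diff_zero le_imp_less_Suc)
  then have "\<not> inj_on ?f {0..?m}" by (rule pigeonhole)
  then obtain k l where kl: "k < l" "l \<le> ?m" "?f k = ?f l"
    unfolding inj_on_def by (metis atLeastAtMost_iff linorder_neqE_nat)
  then have "scale (of_nat l) x - scale (of_nat k) x \<in> B"
    using coset_eq_iff[OF B] by metis
  then have "scale (of_int (int (l - k))) x \<in> B"
    using kl by (simp add: of_nat_diff scale_left_diff_distrib)
  moreover have "l - k dvd fact ?m"
    using kl by (intro dvd_fact) auto
  then obtain q where "fact ?m = (l - k) * q" by blast
  then have "fact ?m = int q * int (l - k)"
    by (metis mult.commute of_nat_fact of_nat_mult)
  then have "scale (of_int (fact ?m)) x = scale (of_int (int q)) (scale (of_int (int (l - k))) x)"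
    by (simp only: scale_scale of_int_mult)
  ultimately show "scale (of_int (fact ?m)) x \<in> B"
    using subgroup_int_multiple[OF B] by (simp only:)
qed

lemma (in vector_space) rank_one_collinear:
  assumes "dim G = 1" "x \<in> G" "y \<in> G" "x \<noteq> 0"
  obtains q where "y = scale q x"
proof -
  obtain B where "G \<subseteq> span B" "card B = 1"
    using basis_exists[of G] assms(1) by metis
  then obtain b where "G \<subseteq> span {b}" by (metis card_1_singletonE)
  then obtain k l where "x = scale k b" "y = scale l b"
    using assms by (fastforce simp: span_singleton)
  moreover from this have "k \<noteq> 0" using assms(4) by auto
  ultimately have "y = scale (l / k) x" by simp
  then show thesis by (rule that)
qed

section \<open>Characterising the regulator; combining direct sums\<close>

lemma completely_decomposable_subgroup: "completely_decomposable scale B \<Longrightarrow> add_subgroup B"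
  by (auto simp: completely_decomposable_def intro: internal_direct_sum_subgroup)

text \<open>The cosets of any smaller competitor map onto those of \<open>C\<close>, so
  \<open>C\<close> has least index. Equal finite index makes that map injective, which forces the
  competitor to equal \<open>C\<close>; hence \<open>C\<close> is the only regulating
  subgroup.\<close>

lemma regulator_eq_greatest:
  assumes C: "finite_index_cd_subgroup scale X C" and X: "add_subgroup X"
    and greatest: "\<And>B. finite_index_cd_subgroup scale X B \<Longrightarrow> B \<subseteq> C"
  shows "regulator scale X = C"
proof -
  have sub: "add_subgroup B" "finite (cosets X B)" "B \<subseteq> X" if "finite_index_cd_subgroup scale X B" for B
    using that by (auto simp: finite_index_cd_subgroup_def intro: completely_decomposable_subgroup)
  have surj: "cosets X C = (\<lambda>K. K + C) ` cosets X B" if "finite_index_cd_subgroup scale X B" for B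
    using sub(1)[OF that] sub(1)[OF C] greatest[OF that] by (rule cosets_supergroup)
  have reg: "regulating_subgroup scale X C"
    using C surj sub(2) unfolding regulating_subgroup_def by (metis card_image_le)
  moreover have "B = C" if B: "regulating_subgroup scale X B" for B
  proof
    have fB: "finite_index_cd_subgroup scale X B" using B by (simp add: regulating_subgroup_def)
    then show "B \<subseteq> C" by (rule greatest)
    have "card (cosets X B) = card (cosets X C)"
      using B reg by (simp add: regulating_subgroup_def le_antisym)
    then have inj: "inj_on (\<lambda>K. K + C) (cosets X B)"
      using surj[OF fB] sub(2)[OF fB] by (metis eq_card_imp_inj_on)
    show "C \<subseteq> B"
    proof
      fix z assume z: "z \<in> C"
      have "(z +o B) + C = (0 +o B) + C"
        using z coset_eq_iff[OF sub(1)[OF C], of z 0]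
        by (simp only: coset_plus_supergroup[OF sub(1)[OF fB] sub(1)[OF C] greatest[OF fB]]) simp
      moreover have "z +o B \<in> cosets X B" "0 +o B \<in> cosets X B"
        using z sub(3)[OF C] add_subgroup_zero[OF X] unfolding cosets_def by blast+
      ultimately have "z +o B = 0 +o B" using inj by (auto dest: inj_onD)
      then show "z \<in> B" using coset_eq_iff[OF sub(1)[OF fB], of z 0] by simp
    qed
  qed
  ultimately have "{A. regulating_subgroup scale X A} = {C}" by blast
  then show ?thesis by (simp add: regulator_def)
qed

lemma internal_direct_sum_cong:
  assumes "internal_direct_sum X I G" "\<And>i. i \<in> I \<Longrightarrow> G i = H i"
  shows "internal_direct_sum X I H"
proof -
  have "sum G I = sum H I" using assms(2) by (intro sum.cong) auto
  then show ?thesis using assms unfolding internal_direct_sum_def by auto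
qed

text \<open>If the total vanishes, the sum over \<open>I\<close> is the negative of the sum over
  \<open>J\<close>, so both lie in \<open>A \<inter> B\<close>.\<close>

lemma internal_direct_sum_Un:
  assumes A: "internal_direct_sum A I G" and B: "internal_direct_sum B J G"
    and IJ: "I \<inter> J = {}" and AB: "A \<inter> B = {0}"
  shows "internal_direct_sum (A + B) (I \<union> J) G"
  unfolding internal_direct_sum_def
proof (intro conjI allI impI)
  have fin: "finite I" "finite J" using A B by (auto simp: internal_direct_sum_def)
  then show "finite (I \<union> J)" by simp
  show "A + B = sum G (I \<union> J)"
    using A B fin IJ by (simp add: internal_direct_sum_def sum.union_disjoint)
  show "\<forall>i\<in>I \<union> J. add_subgroup (G i)"
    using A B by (auto simp: internal_direct_sum_def)
  fix g assume g: "(\<forall>i\<in>I \<union> J. g i \<in> G i) \<and> sum g (I \<union> J) = 0"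
  have "sum g I \<in> A" "sum g J \<in> B"
    using A B fin g by (auto simp: internal_direct_sum_def set_sum_alt)
  moreover have sum: "sum g I = - sum g J"
    using g fin IJ by (simp add: sum.union_disjoint eq_neg_iff_add_eq_0)
  moreover have "- sum g J \<in> B"
    using internal_direct_sum_subgroup[OF B] \<open>sum g J \<in> B\<close> by (simp add: add_subgroup_uminus)
  ultimately have "sum g I \<in> A \<inter> B" by simp
  then have "sum g I = 0" "sum g J = 0" using sum AB by auto
  then have "\<forall>i\<in>I. g i = 0" "\<forall>i\<in>J. g i = 0"
    using A B g unfolding internal_direct_sum_def by blast+
  then show "\<forall>i\<in>I \<union> J. g i = 0" by auto
qed

section \<open>Rank-one groups and cyclic extensions\<close>

locale rat_vector_space = vector_space scale
  for scale :: "rat \<Rightarrow> 'v::ab_group_add \<Rightarrow> 'v"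
begin

lemma add_subgroup_rat_multiples:
  assumes "add_subgroup S"
  shows "add_subgroup (rat_multiples scale S x)"
  unfolding add_subgroup_def rat_multiples_def
proof (intro conjI ballI)
  show "0 \<in> (\<lambda>q. scale q x) ` S"
    using add_subgroup_zero[OF assms] by (force intro: image_eqI[of _ _ 0])
next
  fix y z assume "y \<in> (\<lambda>q. scale q x) ` S" "z \<in> (\<lambda>q. scale q x) ` S"
  then show "y + z \<in> (\<lambda>q. scale q x) ` S"
    using add_subgroup_add[OF assms] by (auto simp flip: scale_left_distrib)
next
  fix y assume "y \<in> (\<lambda>q. scale q x) ` S"
  then show "- y \<in> (\<lambda>q. scale q x) ` S"
    using add_subgroup_uminus[OF assms] by (auto simp flip: scale_minus_left)
qed

lemma rank_one_rat_multiples: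
  assumes "rational_group S" "x \<noteq> 0"
  shows "rank_one scale (rat_multiples scale S x)"
proof -
  have "x \<in> rat_multiples scale S x"
    using assms(1) by (auto simp: rational_group_def rat_multiples_def intro: image_eqI[of _ _ 1])
  moreover have "rat_multiples scale S x \<subseteq> span {x}"
    by (auto simp: rat_multiples_def span_singleton)
  ultimately have "dim (rat_multiples scale S x) = 1"
    using assms(2) by (intro dim_unique[of "{x}"]) auto
  then show ?thesis
    using assms(1) by (simp add: rank_one_def rational_group_def add_subgroup_rat_multiples)
qed

lemma add_subgroup_int_multiples_over: "add_subgroup (int_multiples_over scale e a)"
  unfolding add_subgroup_def int_multiples_over_def
proof (intro conjI ballI)
  show "0 \<in> range (\<lambda>k. scale (of_int k / of_int e) a)"
    by (rule range_eqI[of _ _ 0]) simp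
next
  fix x y assume "x \<in> range (\<lambda>k. scale (of_int k / of_int e) a)"
    "y \<in> range (\<lambda>k. scale (of_int k / of_int e) a)"
  then obtain k l where "x = scale (of_int k / of_int e) a" "y = scale (of_int l / of_int e) a"
    by auto
  then show "x + y \<in> range (\<lambda>k. scale (of_int k / of_int e) a)"
    by (intro range_eqI[of _ _ "k + l"]) (simp add: add_divide_distrib scale_left_distrib)
next
  fix x assume "x \<in> range (\<lambda>k. scale (of_int k / of_int e) a)"
  then obtain k where "x = scale (of_int k / of_int e) a" by auto
  then show "- x \<in> range (\<lambda>k. scale (of_int k / of_int e) a)"
    by (intro range_eqI[of _ _ "- k"]) simp
qed

lemma cyclic_extension_exponent:
  assumes A: "add_subgroup A" and "a \<in> A" "e \<noteq> 0" and x: "x \<in> A + int_multiples_over scale e a"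
  shows "scale (of_int e) x \<in> A"
proof -
  obtain y k where "x = y + scale (of_int k / of_int e) a" "y \<in> A"
    using x by (auto simp: int_multiples_over_def elim!: set_plus_elim)
  then have "scale (of_int e) x = scale (of_int e) y + scale (of_int k) a"
    using \<open>e \<noteq> 0\<close> by (simp add: scale_right_distrib)
  then show ?thesis
    using assms \<open>y \<in> A\<close> by (simp add: add_subgroup_add subgroup_int_multiple)
qed

text \<open>Division with remainder writes \<open>k / e\<close> as an integer plus
  \<open>(k mod e) / e\<close>. The integer part is absorbed by \<open>A\<close>, which leaves at
  most \<open>e\<close> cosets.\<close>

lemma cyclic_extension_finite_index:
  assumes A: "add_subgroup A" and a: "a \<in> A" and e: "e > 0"
  shows "finite (cosets (A + int_multiples_over scale e a) A)"
proof (rule finite_subset)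
  show "cosets (A + int_multiples_over scale e a) A
    \<subseteq> (\<lambda>k. scale (of_int k / of_int e) a +o A) ` {0..<e}"
  proof
    fix K assume "K \<in> cosets (A + int_multiples_over scale e a) A"
    then obtain y k where K: "K = (y + scale (of_int k / of_int e) a) +o A" and y: "y \<in> A"
      by (auto simp: cosets_def int_multiples_over_def elim!: set_plus_elim)
    have "of_int k = of_int e * of_int (k div e) + (of_int (k mod e) :: rat)"
      by (simp flip: of_int_mult of_int_add)
    then have k: "of_int k / of_int e = of_int (k div e) + of_int (k mod e) / (of_int e :: rat)"
      using e by (simp add: field_simps)
    have "(y + scale (of_int k / of_int e) a) - scale (of_int (k mod e) / of_int e) a
        = y + scale (of_int (k div e)) a"
      unfolding k by (simp add: scale_left_distrib)
    also have "\<dots> \<in> A" using A a y by (simp add: add_subgroup_add subgroup_int_multiple)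
    finally have "K = scale (of_int (k mod e) / of_int e) a +o A"
      using K coset_eq_iff[OF A] by simp
    then show "K \<in> (\<lambda>k. scale (of_int k / of_int e) a +o A) ` {0..<e}"
      using e by (intro image_eqI[of _ _ "k mod e"]) auto
  qed
qed simp

end

lemma rational_group_int_multiple:
  assumes "rational_group S" "q \<in> S"
  shows "of_int k * q \<in> S"
proof -
  \<comment> \<open>The rationals are viewed as a vector space over themselves.\<close>
  interpret vector_space "(*) :: rat \<Rightarrow> rat \<Rightarrow> rat"
    by unfold_locales (simp_all add: algebra_simps)
  show ?thesis
    using assms subgroup_int_multiple[of S q k] by (simp add: rational_group_def)
qed

lemma rational_group_of_int: "rational_group S \<Longrightarrow> of_int k \<in> S"
  using rational_group_int_multiple[of S 1 k] by (simp add: rational_group_def)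

section \<open>Coordinates\<close>

text \<open>The \<open>c i\<close> are functionals on the whole space, which the \<open>u i\<close>
  need not span; only their values on the span of the \<open>u i\<close> are determined.\<close>

locale coordinate_frame = rat_vector_space scale
  for scale :: "rat \<Rightarrow> 'v::ab_group_add \<Rightarrow> 'v" +
  fixes I :: "'i set" and u :: "'i \<Rightarrow> 'v" and c :: "'i \<Rightarrow> 'v \<Rightarrow> rat"
  assumes finite_index: "finite I"
    and coord_add: "i \<in> I \<Longrightarrow> c i (x + y) = c i x + c i y"
    and coord_scale: "i \<in> I \<Longrightarrow> c i (scale q x) = q * c i x"
    and coord_basis: "i \<in> I \<Longrightarrow> j \<in> I \<Longrightarrow> c i (u j) = (if i = j then 1 else 0)"
begin

lemma coord_zero: "i \<in> I \<Longrightarrow> c i 0 = 0"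
  using coord_add[of i 0 0] by simp

lemma coord_sum: "i \<in> I \<Longrightarrow> c i (\<Sum>j\<in>S. g j) = (\<Sum>j\<in>S. c i (g j))"
  by (induction S rule: infinite_finite_induct) (auto simp: coord_zero coord_add)

lemma basis_nonzero: "i \<in> I \<Longrightarrow> u i \<noteq> 0"
  using coord_basis[of i i] coord_zero[of i] by auto

lemma inj_on_basis: "inj_on u I"
  using coord_basis by (metis inj_onI zero_neq_one)

lemma coord_combination:
  assumes "i \<in> I" "K \<subseteq> I"
  shows "c i (\<Sum>j\<in>K. scale (q j) (u j)) = (if i \<in> K then q i else 0)"
proof -
  have "c i (\<Sum>j\<in>K. scale (q j) (u j)) = (\<Sum>j\<in>K. if i = j then q j else 0)"
    using assms by (auto simp: coord_sum coord_scale coord_basis intro!: sum.cong)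
  also have "\<dots> = (if i \<in> K then q i else 0)"
    using finite_subset[OF assms(2) finite_index] by simp
  finally show ?thesis .
qed

definition lattice :: "('i \<Rightarrow> rat set) \<Rightarrow> 'v set" where
  "lattice T = (\<Sum>i\<in>I. rat_multiples scale (T i) (u i))"

definition proj :: "'i set \<Rightarrow> 'v \<Rightarrow> 'v" where
  "proj K x = (\<Sum>i\<in>K. scale (c i x) (u i))"

lemma coord_proj: "i \<in> I \<Longrightarrow> K \<subseteq> I \<Longrightarrow> c i (proj K x) = (if i \<in> K then c i x else 0)"
  unfolding proj_def by (rule coord_combination)

lemma proj_add: "K \<subseteq> I \<Longrightarrow> proj K (x + y) = proj K x + proj K y"
  by (auto simp: proj_def coord_add scale_left_distrib subset_iff simp flip: sum.distrib intro!: sum.cong)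

lemma proj_scale: "K \<subseteq> I \<Longrightarrow> proj K (scale q x) = scale q (proj K x)"
  by (auto simp: proj_def coord_scale scale_sum_right subset_iff intro!: sum.cong)

lemma proj_combination: "proj I (\<Sum>j\<in>I. scale (q j) (u j)) = (\<Sum>j\<in>I. scale (q j) (u j))"
  by (auto simp: proj_def coord_combination intro!: sum.cong)

text \<open>Coordinates cannot detect a deviation from the span of the basis; the condition
  \<open>proj I x = x\<close> rules it out.\<close>

lemma mem_lattice_iff: "x \<in> lattice T \<longleftrightarrow> (\<forall>i\<in>I. c i x \<in> T i) \<and> proj I x = x"
proof
  assume "x \<in> lattice T"
  then obtain g where g: "x = sum g I" "\<And>i. i \<in> I \<Longrightarrow> g i \<in> rat_multiples scale (T i) (u i)"
    by (auto simp: lattice_def set_sum_alt[OF finite_index])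
  then have "\<forall>i\<in>I. \<exists>q. q \<in> T i \<and> g i = scale q (u i)"
    by (force simp: rat_multiples_def)
  then obtain q where q: "\<And>i. i \<in> I \<Longrightarrow> q i \<in> T i" "\<And>i. i \<in> I \<Longrightarrow> g i = scale (q i) (u i)"
    by metis
  then have x: "x = (\<Sum>i\<in>I. scale (q i) (u i))" using g by simp
  show "(\<forall>i\<in>I. c i x \<in> T i) \<and> proj I x = x"
    unfolding x using q by (simp add: coord_combination proj_combination)
next
  assume x: "(\<forall>i\<in>I. c i x \<in> T i) \<and> proj I x = x"
  then show "x \<in> lattice T"
    unfolding lattice_def set_sum_alt[OF finite_index] proj_def rat_multiples_def
    by (intro CollectI exI[of _ "\<lambda>i. scale (c i x) (u i)"]) auto
qed

lemma basis_multiple_mem_lattice: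
  assumes "i \<in> I" "\<And>i. i \<in> I \<Longrightarrow> rational_group (T i)"
  shows "scale q (u i) \<in> lattice T \<longleftrightarrow> q \<in> T i"
proof -
  have "(\<Sum>j\<in>I. scale (c j (u i)) (u j)) = (\<Sum>j\<in>I. if j = i then u i else 0)"
    using assms by (intro sum.cong) (auto simp: coord_basis)
  then have "proj I (scale q (u i)) = scale q (u i)"
    using assms finite_index by (simp add: proj_scale) (simp add: proj_def)
  moreover have "0 \<in> T j" if "j \<in> I" for j
    using assms(2)[OF that] by (simp add: rational_group_def add_subgroup_zero)
  ultimately show ?thesis
    using assms(1) by (auto simp: mem_lattice_iff coord_scale coord_basis)
qed

lemma internal_direct_sum_lattice:
  assumes "\<And>i. i \<in> I \<Longrightarrow> add_subgroup (T i)"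
  shows "internal_direct_sum (lattice T) I (\<lambda>i. rat_multiples scale (T i) (u i))"
  unfolding internal_direct_sum_def
proof (intro conjI ballI allI impI)
  fix g i assume g: "(\<forall>i\<in>I. g i \<in> rat_multiples scale (T i) (u i)) \<and> sum g I = 0" and i: "i \<in> I"
  then have "\<forall>i\<in>I. \<exists>q. g i = scale q (u i)"
    by (force simp: rat_multiples_def)
  then obtain q where q: "\<And>i. i \<in> I \<Longrightarrow> g i = scale (q i) (u i)"
    by metis
  then have "(\<Sum>i\<in>I. scale (q i) (u i)) = 0" using g by simp
  then have "q i = 0" using coord_combination[OF i order_refl, of q] i coord_zero by simp
  then show "g i = 0" using q i by simp
qed (auto simp: finite_index lattice_def add_subgroup_rat_multiples assms)

lemma completely_decomposable_lattice:
  assumes T: "\<And>i. i \<in> I \<Longrightarrow> rational_group (T i)"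
  shows "completely_decomposable scale (lattice T)"
proof -
  \<comment> \<open>\<open>completely_decomposable\<close> asks for an index set
    \<open>{..<n}\<close>, so the summands are renumbered.\<close>
  obtain f :: "nat \<Rightarrow> 'i" where f: "bij_betw f {..<card I} I"
    using finite_index ex_bij_betw_nat_finite by (metis atLeast0LessThan)
  have "internal_direct_sum (lattice T) I (\<lambda>i. rat_multiples scale (T i) (u i))"
    using T by (intro internal_direct_sum_lattice) (simp add: rational_group_def)
  then have "internal_direct_sum (lattice T) {..<card I} ((\<lambda>i. rat_multiples scale (T i) (u i)) \<circ> f)"
    using f internal_direct_sum_reindex[of f "{..<card I}"] by (metis bij_betw_def)
  moreover have "rank_one scale (rat_multiples scale (T (f k)) (u (f k)))" if "k < card I" for k
    using that f T basis_nonzero by (intro rank_one_rat_multiples) (auto simp: bij_betw_def)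
  ultimately show ?thesis
    unfolding completely_decomposable_def by (intro exI[of _ "card I"]) auto
qed

end

section \<open>Almost completely decomposable groups\<close>

text \<open>\<open>b i\<close> labels the type of the \<open>i\<close>-th rank-one summand; a block collects the summands of one type.\<close>

locale acd_frame = coordinate_frame scale I u c
  for scale :: "rat \<Rightarrow> 'v::ab_group_add \<Rightarrow> 'v" and I :: "'i set" and u c +
  fixes T :: "'i \<Rightarrow> rat set" and b :: "'i \<Rightarrow> 'k" and X :: "'v set" and N :: int
  assumes T: "i \<in> I \<Longrightarrow> rational_group (T i)"
    and incomparable: "i \<in> I \<Longrightarrow> j \<in> I \<Longrightarrow> b i \<noteq> b j \<Longrightarrow> \<not> type_le (T i) (T j)"
    and X: "add_subgroup X"
    and lattice_le: "lattice T \<subseteq> X"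
    and N: "N > 0"
    and exponent: "x \<in> X \<Longrightarrow> scale (of_int N) x \<in> lattice T"
begin

lemma coord_N: "x \<in> X \<Longrightarrow> i \<in> I \<Longrightarrow> of_int N * c i x \<in> T i"
  using exponent[of x] by (simp add: mem_lattice_iff coord_scale)

lemma proj_index: "x \<in> X \<Longrightarrow> proj I x = x"
  using exponent[of x] N by (simp add: mem_lattice_iff proj_scale)

lemma basis_multiple_mem: "i \<in> I \<Longrightarrow> q \<in> T i \<Longrightarrow> scale q (u i) \<in> X"
  using basis_multiple_mem_lattice[of i T q] T lattice_le by auto

lemma basis_mem: "i \<in> I \<Longrightarrow> u i \<in> X"
  using basis_multiple_mem[of i 1] T by (simp add: rational_group_def)

lemma eq_zero_if_coords_zero: "x \<in> X \<Longrightarrow> (\<And>i. i \<in> I \<Longrightarrow> c i x = 0) \<Longrightarrow> x = 0"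
  using proj_index[of x] by (simp add: proj_def)

context
  fixes h :: "'v \<Rightarrow> 'v"
  assumes h_add: "\<And>x y. x \<in> X \<Longrightarrow> y \<in> X \<Longrightarrow> h (x + y) = h x + h y"
begin

text \<open>Clearing the denominator \<open>n\<close> of \<open>q\<close> leaves integer multiples,
  with which \<open>h\<close> commutes; \<open>n\<close> then cancels in the vector space.\<close>

lemma additive_basis_multiple:
  assumes i: "i \<in> I" and q: "q \<in> T i"
  shows "h (scale q (u i)) = scale q (h (u i))"
proof -
  obtain m n where mn: "quotient_of q = (m, n)" by (cases "quotient_of q")
  then have n: "n > 0" and qmn: "q = of_int m / of_int n"
    by (auto simp: quotient_of_denom_pos quotient_of_div)
  have "scale (of_int n) (h (scale q (u i))) = h (scale (of_int n) (scale q (u i)))"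
    using additive_on_subgroup_int_multiple[OF X basis_multiple_mem[OF i q] h_add] by simp
  also have "scale (of_int n) (scale q (u i)) = scale (of_int m) (u i)"
    using n qmn by simp
  also have "h \<dots> = scale (of_int m) (h (u i))"
    using additive_on_subgroup_int_multiple[OF X basis_mem[OF i] h_add] by simp
  also have "\<dots> = scale (of_int n) (scale q (h (u i)))"
    using n qmn by simp
  finally show ?thesis by (rule scale_left_imp_eq[rotated]) (use n in simp)
qed

text \<open>\<open>N\<close> times \<open>x\<close> lies in the lattice, whose summands are covered
  by \<open>additive_basis_multiple\<close>; the factor \<open>N\<close> is cancelled at the end. So
  \<open>h\<close> is determined on \<open>X\<close> by its values on the basis.\<close>

lemma additive_expansion:
  assumes x: "x \<in> X"
  shows "h x = (\<Sum>i\<in>I. scale (c i x) (h (u i)))"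
proof -
  let ?N = "of_int N :: rat"
  have "scale ?N (h x) = h (scale ?N x)"
    using additive_on_subgroup_int_multiple[OF X x h_add] by simp
  also have "scale ?N x = (\<Sum>i\<in>I. scale (?N * c i x) (u i))"
    using arg_cong[OF proj_index[OF x], of "scale ?N"] by (simp add: proj_def scale_sum_right)
  also have "h \<dots> = (\<Sum>i\<in>I. h (scale (?N * c i x) (u i)))"
    using coord_N[OF x] basis_multiple_mem
    by (intro additive_on_subgroup_sum[OF X h_add finite_index]) auto
  also have "\<dots> = (\<Sum>i\<in>I. scale (?N * c i x) (h (u i)))"
    using coord_N[OF x] by (intro sum.cong refl additive_basis_multiple) auto
  also have "\<dots> = scale ?N (\<Sum>i\<in>I. scale (c i x) (h (u i)))"
    by (simp add: scale_sum_right)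
  finally show ?thesis using N by simp
qed

text \<open>Restricting \<open>h\<close> to the \<open>i\<close>-th summand and reading off the
  \<open>j\<close>-th coordinate would otherwise give a nonzero homomorphism from \<open>T i\<close>
  to \<open>T j\<close>.\<close>

lemma endomorphism_preserves_blocks:
  assumes h_mem: "\<And>x. x \<in> X \<Longrightarrow> h x \<in> X" and i: "i \<in> I" and j: "j \<in> I" and neq: "b i \<noteq> b j"
  shows "c j (h (u i)) = 0"
proof (rule ccontr)
  assume nz: "c j (h (u i)) \<noteq> 0"
  \<comment> \<open>The factor \<open>N\<close> moves the coordinate of a member of \<open>X\<close>
    into \<open>T j\<close>.\<close>
  let ?f = "\<lambda>q. of_int N * c j (h (scale q (u i)))"
  have "type_le (T i) (T j)"
    unfolding type_le_def
  proof (intro exI[of _ ?f] conjI ballI)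
    fix q assume "q \<in> T i"
    then show "?f q \<in> T j" using i j by (intro coord_N h_mem basis_multiple_mem)
  next
    fix q q' assume "q \<in> T i" "q' \<in> T i"
    then show "?f (q + q') = ?f q + ?f q'"
      using i j by (simp add: scale_left_distrib h_add basis_multiple_mem coord_add algebra_simps)
  next
    show "\<exists>q\<in>T i. ?f q \<noteq> 0"
      using nz N T[OF i] by (intro bexI[of _ 1]) (auto simp: rational_group_def)
  qed
  then show False using incomparable[OF i j neq] by simp
qed

end

section \<open>Blocks and the regulator\<close>

definition block :: "'k \<Rightarrow> 'v set" where
  "block k = {x \<in> X. \<forall>i\<in>I. b i \<noteq> k \<longrightarrow> c i x = 0}"

text \<open>A block is the purification in \<open>X\<close> of the summands with one label.
  Endomorphisms of \<open>X\<close> do not mix labels, so each rank-one summand of \<open>B\<close>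
  falls into a single block.\<close>

lemma finite_index_cd_subgroup_le:
  assumes B: "finite_index_cd_subgroup scale X B"
    and C: "add_subgroup C" and blocks: "\<And>k. block k \<subseteq> C"
  shows "B \<subseteq> C"
proof -
  obtain n :: nat and G where G: "internal_direct_sum B {..<n} G" and rk: "\<And>j. j < n \<Longrightarrow> rank_one scale (G j)"
    using B unfolding finite_index_cd_subgroup_def completely_decomposable_def by blast
  have B_sub: "add_subgroup B" using G by (rule internal_direct_sum_subgroup)
  have B_le: "B \<subseteq> X" using B by (simp add: finite_index_cd_subgroup_def)
  obtain m :: int where m: "m > 0" and mB: "\<And>x. x \<in> X \<Longrightarrow> scale (of_int m) x \<in> B"
    using B finite_index_exponent[OF X B_sub] by (auto simp: finite_index_cd_subgroup_def)
  obtain p where p_mem: "\<And>j x. j \<in> {..<n} \<Longrightarrow> x \<in> B \<Longrightarrow> p j x \<in> G j"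
    and p_sum: "\<And>x. x \<in> B \<Longrightarrow> (\<Sum>j<n. p j x) = x"
    and p_add: "\<And>j x y. j \<in> {..<n} \<Longrightarrow> x \<in> B \<Longrightarrow> y \<in> B \<Longrightarrow> p j (x + y) = p j x + p j y"
    and p_id: "\<And>j x. j \<in> {..<n} \<Longrightarrow> x \<in> G j \<Longrightarrow> p j x = x"
    using internal_direct_sum_projections[OF G] by blast
  have G_sub: "add_subgroup (G j)" if "j < n" for j
    using rk[OF that] by (simp add: rank_one_def)
  have G_le: "G j \<subseteq> B" if "j < n" for j
  proof
    fix x assume x: "x \<in> G j"
    let ?g = "\<lambda>i. if i = j then x else 0"
    have "\<forall>i\<in>{..<n}. ?g i \<in> G i" using x G_sub add_subgroup_zero by auto
    moreover have "sum ?g {..<n} = x" using that by simp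
    ultimately show "x \<in> B"
      using G unfolding internal_direct_sum_def set_sum_alt[OF finite_lessThan]
      by (auto intro!: exI[of _ ?g])
  qed
  have G_C: "G j \<subseteq> C" if j: "j < n" for j
  proof (cases "G j \<subseteq> {0}")
    case True
    then show ?thesis using add_subgroup_zero[OF C] by auto
  next
    case False
    then obtain g where g: "g \<in> G j" "g \<noteq> 0" by auto
    have gX: "g \<in> X" using g G_le[OF j] B_le by auto
    \<comment> \<open>Multiplying by \<open>m\<close> turns the projection of \<open>B\<close> onto \<open>G j\<close> into an endomorphism of \<open>X\<close>.\<close>
    define h where "h x = p j (scale (of_int m) x)" for x
    have h_add: "h (x + y) = h x + h y" if "x \<in> X" "y \<in> X" for x y
      using that j by (simp add: h_def scale_right_distrib p_add mB)
    have h_G: "h x \<in> G j" if "x \<in> X" for x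
      using that j by (simp add: h_def p_mem mB)
    have h_mem: "h x \<in> X" if "x \<in> X" for x
      using h_G[OF that] G_le[OF j] B_le by auto
    have "h g = scale (of_int m) g"
      using j g subgroup_int_multiple[OF G_sub[OF j]] by (simp add: h_def p_id)
    then have "h g \<noteq> 0" using g m by simp
    \<comment> \<open>Were all \<open>h (u i)\<close> zero, the expansion of \<open>h g\<close>
      would vanish.\<close>
    then obtain i where i: "i \<in> I" "h (u i) \<noteq> 0"
      using additive_expansion[OF h_add gX] by (metis (mono_tags, lifting) scale_zero_right sum.neutral)
    have "G j \<subseteq> block (b i)"
    proof
      fix x assume x: "x \<in> G j"
      \<comment> \<open>\<open>G j\<close> has rank one, so its members inherit the vanishing
        coordinates of \<open>h (u i)\<close>.\<close>
      obtain q where q: "x = scale q (h (u i))"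
        using rank_one_collinear[of "G j" "h (u i)" x] rk[OF j] x h_G[OF basis_mem[OF i(1)]] i(2)
        by (auto simp: rank_one_def)
      have "c l x = 0" if "l \<in> I" "b l \<noteq> b i" for l
        using that endomorphism_preserves_blocks[OF h_add h_mem i(1), of l] q by (auto simp: coord_scale)
      then show "x \<in> block (b i)"
        using x G_le[OF j] B_le by (auto simp: block_def)
    qed
    then show ?thesis using blocks by blast
  qed
  show ?thesis
  proof
    fix x assume x: "x \<in> B"
    have "(\<Sum>j<n. p j x) \<in> C"
      using p_mem[OF _ x] G_C by (intro add_subgroup_sum[OF C]) auto
    then show "x \<in> C" using p_sum[OF x] by simp
  qed
qed

lemma add_subgroup_lattice:
  assumes "\<And>i. i \<in> I \<Longrightarrow> rational_group (S i)"
  shows "add_subgroup (lattice S)"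
  using assms by (intro completely_decomposable_subgroup[of scale] completely_decomposable_lattice)

lemma regulator_eq_lattice:
  assumes fin: "finite (cosets X (lattice T))" and "\<And>k. block k \<subseteq> lattice T"
  shows "regulator scale X = lattice T"
proof (rule regulator_eq_greatest[OF _ X])
  show "finite_index_cd_subgroup scale X (lattice T)"
    using fin lattice_le T by (auto simp: finite_index_cd_subgroup_def completely_decomposable_lattice)
  show "B \<subseteq> lattice T" if "finite_index_cd_subgroup scale X B" for B
    using that add_subgroup_lattice[OF T] assms(2) by (rule finite_index_cd_subgroup_le)
qed

text \<open>When types do not repeat, the purifications of the rank-one summands sum up to the regulator.\<close>

lemma block_le_regulator:
  assumes fin: "finite (cosets X (lattice T))" and inj: "inj_on b I"
  shows "block k \<subseteq> regulator scale X"
proof -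
  \<comment> \<open>\<open>S i\<close> is the coefficient group of the purification of the
    \<open>i\<close>-th summand in \<open>X\<close>.\<close>
  define S where "S i = {q. scale q (u i) \<in> X}" for i
  have TS: "T i \<subseteq> S i" if "i \<in> I" for i
    using that basis_multiple_mem by (auto simp: S_def)
  have S: "rational_group (S i)" if "i \<in> I" for i
    using basis_mem[OF that] X unfolding rational_group_def add_subgroup_def S_def
    by (auto simp: scale_left_distrib)
  have le: "lattice T \<subseteq> lattice S"
    using TS by (fastforce simp: mem_lattice_iff)
  have SX: "lattice S \<subseteq> X"
  proof
    fix x assume "x \<in> lattice S"
    then have mem: "\<And>i. i \<in> I \<Longrightarrow> scale (c i x) (u i) \<in> X" and px: "proj I x = x"
      by (auto simp: mem_lattice_iff S_def)
    have "proj I x \<in> X" unfolding proj_def using mem by (rule add_subgroup_sum[OF X])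
    then show "x \<in> X" using px by simp
  qed
  have blocks: "block k \<subseteq> lattice S" for k
  proof
    fix x assume x: "x \<in> block k"
    then have xX: "x \<in> X" by (simp add: block_def)
    have "c i x \<in> S i" if i: "i \<in> I" for i
    proof (cases "b i = k")
      case True
      \<comment> \<open>Labels are distinct, so only the \<open>i\<close>-th coordinate of
        \<open>x\<close> can survive.\<close>
      then have "c j x = 0" if "j \<in> I" "j \<noteq> i" for j
        using that x i inj by (auto simp: block_def inj_on_def)
      then have "proj I x = (\<Sum>j\<in>I. if j = i then scale (c i x) (u i) else 0)"
        unfolding proj_def by (intro sum.cong) auto
      then have "x = scale (c i x) (u i)"
        using proj_index[OF xX] i finite_index by simp
      then show ?thesis using xX by (simp add: S_def)
    next
      case False
      then show ?thesis using x i X by (simp add: block_def S_def add_subgroup_zero)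
    qed
    then show "x \<in> lattice S" using proj_index[OF xX] by (simp add: mem_lattice_iff)
  qed
  have sub: "add_subgroup (lattice S)" "add_subgroup (lattice T)"
    using S T by (auto intro: add_subgroup_lattice)
  have "regulator scale X = lattice S"
  proof (rule regulator_eq_greatest[OF _ X])
    have "finite (cosets X (lattice S))"
      unfolding cosets_supergroup[OF sub(2,1) le] using fin by simp
    then show "finite_index_cd_subgroup scale X (lattice S)"
      using SX S by (auto simp: finite_index_cd_subgroup_def completely_decomposable_lattice)
    show "B \<subseteq> lattice S" if "finite_index_cd_subgroup scale X B" for B
      using that sub(1) blocks by (rule finite_index_cd_subgroup_le)
  qed
  then show ?thesis using blocks by simp
qed

text \<open>The complementary projection preserves \<open>X\<close> too, so \<open>X\<close> is the
  direct sum of the two images and one of them is zero. A projection onto a nonempty index set keeps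
  some basis vector, so the corresponding index set is empty.\<close>

lemma indecomposable_proj:
  assumes ind: "indecomposable X" and K: "K \<subseteq> I" and pX: "\<And>x. x \<in> X \<Longrightarrow> proj K x \<in> X"
  shows "K = {} \<or> K = I"
proof -
  let ?K = "I - K"
  have split: "x = proj K x + proj ?K x" if "x \<in> X" for x
    using proj_index[OF that] unfolding proj_def sum.subset_diff[OF K finite_index]
    by (simp add: add.commute)
  have pX': "proj ?K x \<in> X" if "x \<in> X" for x
    using split[OF that] pX[OF that] that add_subgroup_diff[OF X] by (metis add_diff_cancel_left')
  have sub: "add_subgroup (proj L ` X)" if "L \<subseteq> I" for L
    unfolding add_subgroup_def
  proof (intro conjI ballI)
    show "0 \<in> proj L ` X"
      using add_subgroup_zero[OF X] proj_scale[OF that, of 0 0] by force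
  next
    fix x y assume "x \<in> proj L ` X" "y \<in> proj L ` X"
    then show "x + y \<in> proj L ` X"
      using add_subgroup_add[OF X] by (auto simp flip: proj_add[OF that])
  next
    fix x assume "x \<in> proj L ` X"
    then obtain y where y: "y \<in> X" "x = proj L y" by auto
    then have "- x = proj L (- y)" using proj_scale[OF that, of "-1" y] by simp
    then show "- x \<in> proj L ` X" using add_subgroup_uminus[OF X y(1)] by simp
  qed
  have "proj K ` X \<inter> proj ?K ` X = {0}"
  proof -
    have "z = 0" if z: "z = proj K x" "z = proj ?K y" "x \<in> X" for x y z
    proof (rule eq_zero_if_coords_zero)
      show "z \<in> X" using z pX by simp
      show "c i z = 0" if "i \<in> I" for i
        using z coord_proj[OF that K, of x] coord_proj[OF that, of ?K y] by (auto split: if_splits)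
    qed
    then show ?thesis
      using add_subgroup_zero[OF sub[OF K]] add_subgroup_zero[OF sub, of ?K] by blast
  qed
  moreover have "X = proj K ` X + proj ?K ` X"
  proof (intro equalityI subsetI)
    fix x assume "x \<in> X"
    then show "x \<in> proj K ` X + proj ?K ` X"
      using split[of x] by (metis imageI set_plus_intro)
  qed (use pX pX' add_subgroup_add[OF X] in \<open>auto elim!: set_plus_elim\<close>)
  ultimately have trivial: "proj K ` X = {0} \<or> proj ?K ` X = {0}"
    using ind sub[OF K] sub[of ?K] unfolding indecomposable_def by blast
  have empty: "L = {}" if L: "L \<subseteq> I" "proj L ` X = {0}" for L
  proof (rule ccontr)
    assume "L \<noteq> {}"
    then obtain i where i: "i \<in> L" "i \<in> I" using L(1) by blast
    have "proj L (u i) = 0" using L(2) basis_mem[OF i(2)] by blast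
    then show False
      using coord_proj[OF i(2) L(1), of "u i"] i by (simp add: coord_basis coord_zero)
  qed
  show ?thesis using trivial empty[OF K] empty[of ?K] K by auto
qed

text \<open>A converse to \<open>indecomposable_proj\<close>: when labels are distinct, the
  projection onto \<open>B\<close> along \<open>C\<close> is a coordinate projection, so every
  decomposition of \<open>X\<close> comes from a partition of the index set.\<close>

lemma indecomposable_if_proj:
  assumes inj: "inj_on b I" and "I \<noteq> {}"
    and proj_X: "\<And>K. K \<subseteq> I \<Longrightarrow> (\<And>x. x \<in> X \<Longrightarrow> proj K x \<in> X) \<Longrightarrow> K = {} \<or> K = I"
  shows "indecomposable X"
  unfolding indecomposable_def
proof (intro conjI allI impI)
  show "X \<noteq> {0}" using \<open>I \<noteq> {}\<close> basis_mem basis_nonzero by blast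
  fix B C assume BC: "add_subgroup B \<and> add_subgroup C \<and> B \<inter> C = {0} \<and> X = B + C"
  then have B: "add_subgroup B" and C: "add_subgroup C" and BC0: "B \<inter> C = {0}" and XBC: "X = B + C"
    by auto
  have uniq: "x = x'" if "x \<in> B" "x' \<in> B" "y \<in> C" "y' \<in> C" "x + y = x' + y'" for x x' y y'
  proof -
    have "x - x' = y' - y" using that(5) by (simp add: algebra_simps)
    moreover have "x - x' \<in> B" "y' - y \<in> C" using that B C by (auto intro: add_subgroup_diff)
    ultimately have "x - x' \<in> B \<inter> C" by simp
    then show ?thesis using BC0 by simp
  qed
  have "\<forall>x\<in>X. \<exists>y. y \<in> B \<and> x - y \<in> C"
    unfolding XBC by (force elim!: set_plus_elim)
  then obtain h where h: "\<And>x. x \<in> X \<Longrightarrow> h x \<in> B" "\<And>x. x \<in> X \<Longrightarrow> x - h x \<in> C" by metis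
  have BX: "B \<subseteq> X" and CX: "C \<subseteq> X"
    using set_zero_plus2[OF add_subgroup_zero[OF C], of B] set_zero_plus2[OF add_subgroup_zero[OF B], of C]
    by (auto simp: XBC add.commute)
  have h_eq: "h x = y" if "x \<in> X" "y \<in> B" "x - y \<in> C" for x y
    using uniq[of "h x" y "x - h x" "x - y"] h that by simp
  have h_add: "h (x + y) = h x + h y" if "x \<in> X" "y \<in> X" for x y
  proof (rule h_eq)
    show "x + y - (h x + h y) \<in> C"
      using add_subgroup_add[OF C h(2)[OF that(1)] h(2)[OF that(2)]] by (simp add: algebra_simps)
  qed (use that h B X in \<open>auto intro: add_subgroup_add\<close>)
  have hX: "h x \<in> X" if "x \<in> X" for x using h(1)[OF that] BX by auto
  have h_B: "h x = x" if "x \<in> B" for x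
    using that h_eq[of x x] BX C by (auto simp: add_subgroup_zero)
  have h_C: "h x = 0" if "x \<in> C" for x
    using that h_eq[of x 0] CX B by (auto simp: add_subgroup_zero)
  \<comment> \<open>The projection \<open>h\<close> onto \<open>B\<close> respects types, so it is an idempotent on each rank-one summand.\<close>
  have h_basis: "h (u i) = u i \<or> h (u i) = 0" if i: "i \<in> I" for i
  proof -
    have "c j (h (u i)) = 0" if "j \<in> I" "j \<noteq> i" for j
      using endomorphism_preserves_blocks[OF h_add hX i, of j] that inj i by (auto simp: inj_on_def)
    then have "proj I (h (u i)) = (\<Sum>j\<in>I. if j = i then scale (c i (h (u i))) (u i) else 0)"
      unfolding proj_def by (intro sum.cong) auto
    then have q: "h (u i) = scale (c i (h (u i))) (u i)" (is "_ = scale ?q _")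
      using proj_index[OF hX[OF basis_mem[OF i]]] i finite_index by simp
    have "h (h (u i)) = (\<Sum>j\<in>I. scale (c j (h (u i))) (h (u j)))"
      by (rule additive_expansion[OF h_add hX[OF basis_mem[OF i]]])
    also have "\<dots> = (\<Sum>j\<in>I. if j = i then scale ?q (h (u i)) else 0)"
      using \<open>\<And>j. j \<in> I \<Longrightarrow> j \<noteq> i \<Longrightarrow> c j (h (u i)) = 0\<close> by (intro sum.cong) auto
    also have "\<dots> = scale ?q (h (u i))" using i finite_index by simp
    finally have "h (u i) = scale ?q (h (u i))"
      using h_B[OF h(1)[OF basis_mem[OF i]]] by simp
    then have "?q = ?q * ?q" using coord_scale[OF i] by metis
    then have "?q = 0 \<or> ?q = 1" by simp
    then show ?thesis using q by (metis scale_one scale_zero_left)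
  qed
  \<comment> \<open>\<open>K\<close> records the basis vectors lying in \<open>B\<close>; by
    \<open>h_basis\<close> the others lie in \<open>C\<close>.\<close>
  define K where "K = {i \<in> I. h (u i) = u i}"
  have K: "K \<subseteq> I" by (auto simp: K_def)
  have h_proj: "h x = proj K x" if "x \<in> X" for x
  proof -
    have "h x = (\<Sum>i\<in>I. if i \<in> K then scale (c i x) (u i) else 0)"
      by (subst additive_expansion[OF h_add that], simp, simp, intro sum.cong)
        (use h_basis in \<open>auto simp: K_def\<close>)
    also have "\<dots> = proj K x"
      unfolding proj_def using K finite_index by (simp add: sum.If_cases Int_absorb1)
    finally show ?thesis .
  qed
  have "K = {} \<or> K = I"
    using K hX h_proj by (intro proj_X) auto
  then show "B = {0} \<or> C = {0}"
  proof
    assume "K = {}"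
    then have "x = 0" if "x \<in> B" for x
      using h_proj[of x] h_B[OF that] that BX by (auto simp: proj_def)
    then show ?thesis using add_subgroup_zero[OF B] by blast
  next
    assume "K = I"
    then have "x = 0" if "x \<in> C" for x
      using h_proj[of x] h_C[OF that] proj_index[of x] that CX by auto
    then show ?thesis using add_subgroup_zero[OF C] by blast
  qed
qed

end

section \<open>Cyclic extensions and direct sums\<close>

context rat_vector_space
begin

text \<open>Directness speaks only of coefficients in the \<open>T i\<close>. The product
  \<open>m\<close> of all denominators turns the coefficients into integers, which every rational
  group contains.\<close>

lemma direct_sum_independent:
  assumes A: "internal_direct_sum A I (\<lambda>i. rat_multiples scale (T i) (u i))"
    and T: "\<And>i. i \<in> I \<Longrightarrow> rational_group (T i)" and nz: "\<And>i. i \<in> I \<Longrightarrow> u i \<noteq> 0"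
    and sum: "(\<Sum>i\<in>I. scale (q i) (u i)) = 0" and i: "i \<in> I"
  shows "q i = 0"
proof -
  have fin: "finite I" using A by (simp add: internal_direct_sum_def)
  define m where "m = (\<Prod>i\<in>I. snd (quotient_of (q i)))"
  have m: "m \<noteq> 0"
    unfolding m_def using fin quotient_of_denom_pos'[of "q _"] by (simp add: less_imp_neq[symmetric])
  have mem: "of_int m * q j \<in> T j" if j: "j \<in> I" for j
  proof -
    have "snd (quotient_of (q j)) dvd m"
      unfolding m_def using fin j by (rule dvd_prodI)
    then obtain k where "m = snd (quotient_of (q j)) * k" by blast
    moreover have "q j = of_int (fst (quotient_of (q j))) / of_int (snd (quotient_of (q j)))"
      by (rule quotient_of_div) simp
    ultimately have "of_int m * q j = of_int (k * fst (quotient_of (q j)))"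
      using quotient_of_denom_pos'[of "q j"] by (simp add: field_simps)
    then show ?thesis using rational_group_of_int[OF T[OF j]] by (simp only:)
  qed
  have "(\<Sum>i\<in>I. scale (of_int m * q i) (u i)) = scale (of_int m) (\<Sum>i\<in>I. scale (q i) (u i))"
    by (simp add: scale_sum_right)
  then have "(\<Sum>i\<in>I. scale (of_int m * q i) (u i)) = 0" using sum by simp
  moreover have "\<forall>i\<in>I. scale (of_int m * q i) (u i) \<in> rat_multiples scale (T i) (u i)"
    using mem by (auto simp: rat_multiples_def)
  ultimately have "scale (of_int m * q i) (u i) = 0"
    using A i unfolding internal_direct_sum_def
    by (metis (mono_tags, lifting))
  then show ?thesis using nz[OF i] m by simp
qed

text \<open>The coordinates are the dual functionals of an independent family, extended linearly to
  the whole space.\<close>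

lemma coordinate_frame_exists:
  assumes fin: "finite I"
    and indep: "\<And>q i. (\<Sum>i\<in>I. scale (q i) (u i)) = 0 \<Longrightarrow> i \<in> I \<Longrightarrow> q i = 0"
  obtains c where "coordinate_frame scale I u c"
proof -
  have inj: "inj_on u I"
  proof (rule inj_onI, rule ccontr)
    fix i j assume ij: "i \<in> I" "j \<in> I" "u i = u j" "i \<noteq> j"
    \<comment> \<open>Equal vectors at distinct indices would satisfy a relation with coefficients 1
      and -1.\<close>
    let ?q = "\<lambda>k. (if k = i then 1 else 0) - (if k = j then 1 else 0)"
    have "(\<Sum>k\<in>I. scale (?q k) (u k))
        = (\<Sum>k\<in>I. if k = i then u i else 0) - (\<Sum>k\<in>I. if k = j then u j else 0)"
      unfolding sum_subtractf[symmetric] by (intro sum.cong) auto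
    also have "\<dots> = 0" using ij fin by simp
    finally show False using indep[of ?q i] ij by simp
  qed
  have "independent (u ` I)"
    unfolding dependent_finite[OF finite_imageI[OF fin]]
  proof clarify
    fix q i assume "i \<in> I" "(\<Sum>x\<in>u ` I. scale (q x) x) = 0" and nz: "q (u i) \<noteq> 0"
    then show False using indep[of "q \<circ> u" i] by (simp add: sum.reindex[OF inj])
  qed
  interpret pair: vector_space_pair scale "(*) :: rat \<Rightarrow> rat \<Rightarrow> rat"
    by unfold_locales (simp_all add: algebra_simps)
  have "\<forall>i. \<exists>g. Vector_Spaces.linear scale (*) g \<and> (\<forall>x\<in>u ` I. g x = (if x = u i then 1 else 0))"
    by (intro allI pair.linear_independent_extend \<open>independent (u ` I)\<close>)
  then obtain c where lin: "\<And>i. Vector_Spaces.linear scale (*) (c i)"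
    and c: "\<And>i. \<forall>x\<in>u ` I. c i x = (if x = u i then 1 else 0)" by metis
  have "coordinate_frame scale I u c"
  proof unfold_locales
    fix i x y q assume "i \<in> I"
    interpret l: Vector_Spaces.linear scale "(*)" "c i" by (rule lin)
    show "c i (x + y) = c i x + c i y" by (rule l.add)
    show "c i (scale q x) = q * c i x" by (rule l.scale)
  next
    fix i j assume "i \<in> I" "j \<in> I"
    then show "c i (u j) = (if i = j then 1 else 0)"
      using c[of i] inj by (auto simp: inj_on_def)
  qed (rule fin)
  then show thesis by (rule that)
qed

text \<open>With \<open>m * e\<^sub>1 + n * e\<^sub>2 = 1\<close>, the multiple of the new generator
  by \<open>n * e\<^sub>2\<close> agrees with the first old generator up to a member of
  \<open>A\<^sub>1 + A\<^sub>2\<close>. The second one is then reached by subtraction.\<close>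

lemma cyclic_extensions_sum:
  assumes A\<^sub>1: "add_subgroup A\<^sub>1" and A\<^sub>2: "add_subgroup A\<^sub>2" and a\<^sub>1: "a\<^sub>1 \<in> A\<^sub>1" and a\<^sub>2: "a\<^sub>2 \<in> A\<^sub>2"
    and e: "0 < e\<^sub>1" "0 < e\<^sub>2" "coprime e\<^sub>1 e\<^sub>2"
  shows "(A\<^sub>1 + int_multiples_over scale e\<^sub>1 a\<^sub>1) + (A\<^sub>2 + int_multiples_over scale e\<^sub>2 a\<^sub>2)
    = (A\<^sub>1 + A\<^sub>2)
      + int_multiples_over scale (e\<^sub>1 * e\<^sub>2) (scale (of_int e\<^sub>2) a\<^sub>1 + scale (of_int e\<^sub>1) a\<^sub>2)"
    (is "?L = _ + int_multiples_over _ _ ?a")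
proof -
  let ?R = "(A\<^sub>1 + A\<^sub>2) + int_multiples_over scale (e\<^sub>1 * e\<^sub>2) ?a"
  have R: "add_subgroup ?R" and A12: "add_subgroup (A\<^sub>1 + A\<^sub>2)"
    using A\<^sub>1 A\<^sub>2 by (auto intro!: add_subgroup_plus add_subgroup_int_multiples_over)
  have A_R: "x + y \<in> ?R" if "x \<in> A\<^sub>1" "y \<in> A\<^sub>2" for x y
    using that add_subgroup_zero[OF add_subgroup_int_multiples_over, of "e\<^sub>1 * e\<^sub>2" ?a]
    by (metis add.right_neutral set_plus_intro)
  have a_R: "scale (of_int k / of_int (e\<^sub>1 * e\<^sub>2)) ?a \<in> ?R" for k
  proof -
    have "0 + scale (of_int k / of_int (e\<^sub>1 * e\<^sub>2)) ?a \<in> ?R"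
      using A12 by (intro set_plus_intro) (auto simp: int_multiples_over_def add_subgroup_zero)
    then show ?thesis by simp
  qed
  have a: "scale (of_int k / of_int (e\<^sub>1 * e\<^sub>2)) ?a
      = scale (of_int k / of_int e\<^sub>1) a\<^sub>1 + scale (of_int k / of_int e\<^sub>2) a\<^sub>2" for k
    using e by (simp add: scale_right_distrib)
  obtain m n where mn: "m * e\<^sub>1 + n * e\<^sub>2 = 1"
    using e(3) by (metis bezout_int coprime_iff_gcd_eq_1)
  have mn': "of_int m * of_int e\<^sub>1 + of_int n * of_int e\<^sub>2 = (1::rat)"
    using arg_cong[OF mn, of "of_int :: int \<Rightarrow> rat"] by simp
  have x_R: "scale (of_int k / of_int e\<^sub>1) a\<^sub>1 \<in> ?R" for k
  proof -
    have "of_int k / of_int e\<^sub>1 = of_int (k * n * e\<^sub>2) / of_int e\<^sub>1 + (of_int (k * m) :: rat)"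
    proof -
      have "of_int k = of_int k * (of_int m * of_int e\<^sub>1 + of_int n * of_int e\<^sub>2 :: rat)"
        using mn' by simp
      then show ?thesis using e by (simp add: field_simps)
    qed
    then have "scale (of_int k / of_int e\<^sub>1) a\<^sub>1
        = scale (of_int (k * n * e\<^sub>2) / of_int e\<^sub>1) a\<^sub>1 + scale (of_int (k * m)) a\<^sub>1"
      by (simp only: scale_left_distrib)
    also have "scale (of_int (k * n * e\<^sub>2) / of_int e\<^sub>1) a\<^sub>1
        = scale (of_int (k * n * e\<^sub>2) / of_int (e\<^sub>1 * e\<^sub>2)) ?a + - scale (of_int (k * n)) a\<^sub>2"
      unfolding a using e by simp
    finally have "scale (of_int k / of_int e\<^sub>1) a\<^sub>1
        = scale (of_int (k * n * e\<^sub>2) / of_int (e\<^sub>1 * e\<^sub>2)) ?a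
          + (scale (of_int (k * m)) a\<^sub>1 + - scale (of_int (k * n)) a\<^sub>2)" by (simp only: ac_simps)
    also have "\<dots> \<in> ?R"
      using R A\<^sub>1 A\<^sub>2 a\<^sub>1 a\<^sub>2
      by (intro add_subgroup_add[OF R] a_R A_R add_subgroup_uminus subgroup_int_multiple)
    finally show ?thesis .
  qed
  have y_R: "scale (of_int k / of_int e\<^sub>2) a\<^sub>2 \<in> ?R" for k
    using add_subgroup_diff[OF R a_R[of k] x_R[of k]] unfolding a by simp
  show ?thesis
  proof (intro equalityI subsetI)
    fix z assume "z \<in> ?L"
    then obtain x y k l where "x \<in> A\<^sub>1" "y \<in> A\<^sub>2"
      "z = (x + scale (of_int k / of_int e\<^sub>1) a\<^sub>1) + (y + scale (of_int l / of_int e\<^sub>2) a\<^sub>2)"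
      by (auto simp: int_multiples_over_def elim!: set_plus_elim)
    then have "z = (x + y) + (scale (of_int k / of_int e\<^sub>1) a\<^sub>1 + scale (of_int l / of_int e\<^sub>2) a\<^sub>2)"
      by (simp add: ac_simps)
    also have "\<dots> \<in> ?R"
      using \<open>x \<in> A\<^sub>1\<close> \<open>y \<in> A\<^sub>2\<close> by (intro add_subgroup_add[OF R] A_R x_R y_R)
    finally show "z \<in> ?R" .
  next
    fix z assume "z \<in> ?R"
    then obtain x y k where xy: "x \<in> A\<^sub>1" "y \<in> A\<^sub>2"
      and "z = x + y + scale (of_int k / of_int (e\<^sub>1 * e\<^sub>2)) ?a"
      by (auto simp: int_multiples_over_def elim!: set_plus_elim)
    then have "z = (x + scale (of_int k / of_int e\<^sub>1) a\<^sub>1) + (y + scale (of_int k / of_int e\<^sub>2) a\<^sub>2)"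
      unfolding a by (simp add: ac_simps)
    then show "z \<in> ?L" using xy by (auto simp: int_multiples_over_def)
  qed
qed

end

section \<open>Frames on subsets, cyclic extensions, and pairs of groups\<close>

context coordinate_frame
begin

lemma coordinate_frame_subset: "K \<subseteq> I \<Longrightarrow> coordinate_frame scale K u c"
  using finite_index finite_subset
  by unfold_locales (auto simp: coord_add coord_scale coord_basis subset_iff)

lemma proj_mem_lattice:
  assumes "x \<in> lattice T" "K \<subseteq> I" "\<And>i. i \<in> I \<Longrightarrow> rational_group (T i)"
  shows "proj K x \<in> lattice T"
proof -
  have "proj I (proj K x) = (\<Sum>i\<in>I. if i \<in> K then scale (c i x) (u i) else 0)"
    unfolding proj_def[of I] using assms(2) by (intro sum.cong) (auto simp: coord_proj)
  also have "\<dots> = proj K x"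
    unfolding proj_def using assms(2) finite_index by (simp add: sum.If_cases Int_absorb1)
  finally show ?thesis
    using assms by (auto simp: mem_lattice_iff coord_proj rational_group_def add_subgroup_zero)
qed

lemma acd_frame_cyclic_extension:
  assumes "\<And>i. i \<in> I \<Longrightarrow> rational_group (T i)"
    and "\<And>i j. i \<in> I \<Longrightarrow> j \<in> I \<Longrightarrow> b i \<noteq> b j \<Longrightarrow> \<not> type_le (T i) (T j)"
    and "a \<in> lattice T" "e > 0"
  shows "acd_frame scale I u c T b (lattice T + int_multiples_over scale e a) e"
proof unfold_locales
  have L: "add_subgroup (lattice T)"
    using assms(1) by (intro completely_decomposable_subgroup[of scale] completely_decomposable_lattice)
  then show "add_subgroup (lattice T + int_multiples_over scale e a)"
    by (intro add_subgroup_plus add_subgroup_int_multiples_over)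
  show "lattice T \<subseteq> lattice T + int_multiples_over scale e a"
    using set_zero_plus2[OF add_subgroup_zero[OF add_subgroup_int_multiples_over]]
    by (metis add.commute)
  show "scale (of_int e) x \<in> lattice T" if "x \<in> lattice T + int_multiples_over scale e a" for x
    using L that assms by (intro cyclic_extension_exponent[where a = a]) auto
qed (use assms in auto)

lemma int_combination_mem_lattice:
  assumes "\<And>i. i \<in> I \<Longrightarrow> rational_group (T i)"
  shows "(\<Sum>i\<in>I. scale (of_int (k i)) (u i)) \<in> lattice T"
  using assms by (auto simp: mem_lattice_iff proj_combination coord_combination intro: rational_group_of_int)

end

text \<open>The index sets are disjoint while \<open>T\<close> and \<open>b\<close> are shared, so
  that a type occurring in both groups can carry the same label in each.\<close>

locale acd_frame_pair = coordinate_frame scale "I\<^sub>1 \<union> I\<^sub>2" u c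
  + F\<^sub>1: acd_frame scale I\<^sub>1 u c T b X\<^sub>1 N\<^sub>1 + F\<^sub>2: acd_frame scale I\<^sub>2 u c T b X\<^sub>2 N\<^sub>2
  for scale :: "rat \<Rightarrow> 'v::ab_group_add \<Rightarrow> 'v" and I\<^sub>1 I\<^sub>2 :: "'i set" and u c T
    and b :: "'i \<Rightarrow> 'k" and X\<^sub>1 N\<^sub>1 X\<^sub>2 N\<^sub>2 +
  assumes disjoint: "I\<^sub>1 \<inter> I\<^sub>2 = {}"
begin

lemma coord\<^sub>1: "x \<in> X\<^sub>1 \<Longrightarrow> i \<in> I\<^sub>2 \<Longrightarrow> c i x = 0"
  using F\<^sub>1.proj_index[of x] coord_proj[of i I\<^sub>1 x] disjoint by (auto split: if_splits)

lemma coord\<^sub>2: "x \<in> X\<^sub>2 \<Longrightarrow> i \<in> I\<^sub>1 \<Longrightarrow> c i x = 0"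
  using F\<^sub>2.proj_index[of x] coord_proj[of i I\<^sub>2 x] disjoint by (auto split: if_splits)

lemma lattice_Un: "lattice T = F\<^sub>1.lattice T + F\<^sub>2.lattice T"
  unfolding lattice_def F\<^sub>1.lattice_def F\<^sub>2.lattice_def
  using F\<^sub>1.finite_index F\<^sub>2.finite_index disjoint by (rule sum.union_disjoint)

text \<open>Members of \<open>X\<^sub>1\<close> and \<open>X\<^sub>2\<close> have coordinates on
  disjoint index sets, so the two components of a member of a block again lie in the blocks of that
  label.\<close>

lemma regulator_sum:
  assumes "acd_frame scale (I\<^sub>1 \<union> I\<^sub>2) u c T b (X\<^sub>1 + X\<^sub>2) N"
    and "finite (cosets (X\<^sub>1 + X\<^sub>2) (lattice T))"
    and "\<And>k. F\<^sub>1.block k \<subseteq> F\<^sub>1.lattice T" "\<And>k. F\<^sub>2.block k \<subseteq> F\<^sub>2.lattice T"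
  shows "regulator scale (X\<^sub>1 + X\<^sub>2) = lattice T"
proof -
  interpret F: acd_frame scale "I\<^sub>1 \<union> I\<^sub>2" u c T b "X\<^sub>1 + X\<^sub>2" N by fact
  have "F.block k \<subseteq> lattice T" for k
  proof
    fix x assume x: "x \<in> F.block k"
    then obtain y z where yz: "y \<in> X\<^sub>1" "z \<in> X\<^sub>2" "x = y + z"
      by (auto simp: F.block_def elim!: set_plus_elim)
    have "y \<in> F\<^sub>1.block k" "z \<in> F\<^sub>2.block k"
      using x yz coord\<^sub>1[of y] coord\<^sub>2[of z]
      by (auto simp: F.block_def F\<^sub>1.block_def F\<^sub>2.block_def coord_add)
    then show "x \<in> lattice T"
      using assms(3,4)[of k] yz unfolding lattice_Un by auto
  qed
  with assms(2) show ?thesis by (rule F.regulator_eq_lattice)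
qed

text \<open>On \<open>X\<^sub>1\<close> only coordinates in \<open>I\<^sub>1\<close> count, so both
  projections agree there. The \<open>X\<^sub>2\<close> component of the image has zero coordinates
  and vanishes. \<open>K\<close> is a set of labels, so one choice of types acts on both groups at
  once.\<close>

lemma proj_summand:
  assumes "\<And>x. x \<in> X\<^sub>1 + X\<^sub>2 \<Longrightarrow> proj {i \<in> I\<^sub>1 \<union> I\<^sub>2. b i \<in> K} x \<in> X\<^sub>1 + X\<^sub>2" and x: "x \<in> X\<^sub>1"
  shows "proj {i \<in> I\<^sub>1. b i \<in> K} x \<in> X\<^sub>1"
proof -
  let ?K = "{i \<in> I\<^sub>1. b i \<in> K}"
  have "x + 0 \<in> X\<^sub>1 + X\<^sub>2"
    using x add_subgroup_zero[OF F\<^sub>2.X] by (rule set_plus_intro)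
  moreover have "proj {i \<in> I\<^sub>1 \<union> I\<^sub>2. b i \<in> K} x = proj ?K x"
    unfolding proj_def using finite_index coord\<^sub>1[OF x] by (intro sum.mono_neutral_right) auto
  ultimately have "proj ?K x \<in> X\<^sub>1 + X\<^sub>2" using assms(1)[of x] by simp
  then obtain y z where yz: "y \<in> X\<^sub>1" "z \<in> X\<^sub>2" "proj ?K x = y + z"
    by (auto elim!: set_plus_elim)
  have "c i z = 0" if "i \<in> I\<^sub>2" for i
  proof -
    have "c i (proj ?K x) = 0"
      using that disjoint by (subst coord_proj) auto
    then show ?thesis using that coord\<^sub>1[OF yz(1) that] by (simp add: yz(3) coord_add)
  qed
  then have "z = 0" by (rule F\<^sub>2.eq_zero_if_coords_zero[OF yz(2)])
  then show ?thesis using yz by simp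
qed

text \<open>Makes \<open>proj_summand\<close> available for \<open>X\<^sub>2\<close>.\<close>

lemma swap: "acd_frame_pair scale I\<^sub>2 I\<^sub>1 u c T b X\<^sub>2 N\<^sub>2 X\<^sub>1 N\<^sub>1"
proof -
  have "coordinate_frame scale (I\<^sub>2 \<union> I\<^sub>1) u c"
    using coordinate_frame_axioms by (simp add: Un_commute)
  then show ?thesis
    using F\<^sub>1.acd_frame_axioms F\<^sub>2.acd_frame_axioms disjoint
    by (auto simp: acd_frame_pair_def acd_frame_pair_axioms_def)
qed

end

section \<open>Unimodular change of basis\<close>

text \<open>For \<open>i\<close> in \<open>D\<close> the indices \<open>Inl i\<close> and
  \<open>Inr i\<close> form a pair, on which the integer matrix with rows \<open>(a i, b i)\<close>
  and \<open>(p i, q i)\<close> acts.\<close>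

locale unimodular_change = coordinate_frame scale "Inl ` S \<union> Inr ` D" u c
  for scale :: "rat \<Rightarrow> 'v::ab_group_add \<Rightarrow> 'v" and S D :: "'k set" and u c +
  fixes a b p q :: "'k \<Rightarrow> int"
  assumes D: "D \<subseteq> S" and det: "i \<in> D \<Longrightarrow> a i * q i - b i * p i = 1"
begin

definition new_basis :: "'k + 'k \<Rightarrow> 'v" where
  "new_basis = case_sum
     (\<lambda>i. if i \<in> D then scale (of_int (a i)) (u (Inl i)) + scale (of_int (b i)) (u (Inr i)) else u (Inl i))
     (\<lambda>i. scale (of_int (p i)) (u (Inl i)) + scale (of_int (q i)) (u (Inr i)))"

text \<open>The functionals dual to \<open>new_basis\<close>: for determinant 1 the inverse of a
  2-by-2 matrix is its adjugate.\<close>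

definition new_coord :: "'k + 'k \<Rightarrow> 'v \<Rightarrow> rat" where
  "new_coord = case_sum
     (\<lambda>i x. if i \<in> D then of_int (q i) * c (Inl i) x - of_int (p i) * c (Inr i) x else c (Inl i) x)
     (\<lambda>i x. of_int (a i) * c (Inr i) x - of_int (b i) * c (Inl i) x)"

lemma det_rat: "i \<in> D \<Longrightarrow> of_int (a i) * of_int (q i) - of_int (b i) * of_int (p i) = (1::rat)"
  using arg_cong[OF det, of i "of_int :: int \<Rightarrow> rat"] by simp

lemma new_frame: "coordinate_frame scale (Inl ` S \<union> Inr ` D) new_basis new_coord"
proof unfold_locales
  fix i j assume "i \<in> Inl ` S \<union> Inr ` D" "j \<in> Inl ` S \<union> Inr ` D"
  then show "new_coord i (new_basis j) = (if i = j then 1 else 0)"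
    using D det_rat
    by (auto simp: new_coord_def new_basis_def coord_add coord_scale coord_basis subset_iff
        algebra_simps split: if_splits)
next
  fix i x y z assume "i \<in> Inl ` S \<union> Inr ` D"
  then show "new_coord i (x + y) = new_coord i x + new_coord i y"
    "new_coord i (scale z x) = z * new_coord i x"
    using D by (auto simp: new_coord_def coord_add coord_scale subset_iff algebra_simps)
qed (rule finite_index)

sublocale new: coordinate_frame scale "Inl ` S \<union> Inr ` D" new_basis new_coord
  by (rule new_frame)

text \<open>The change takes place inside the plane of each pair, so the component in that plane is
  the same for both bases.\<close>

lemma new_pair:
  assumes "i \<in> D"
  shows "scale (new_coord (Inl i) x) (new_basis (Inl i)) + scale (new_coord (Inr i) x) (new_basis (Inr i))
    = scale (c (Inl i) x) (u (Inl i)) + scale (c (Inr i) x) (u (Inr i))"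
proof -
  let ?a = "of_int (a i) :: rat" and ?b = "of_int (b i) :: rat"
    and ?p = "of_int (p i) :: rat" and ?q = "of_int (q i) :: rat"
  let ?y = "c (Inl i) x" and ?z = "c (Inr i) x"
  have "(?q * ?y - ?p * ?z) * ?a + (?a * ?z - ?b * ?y) * ?p = (?a * ?q - ?b * ?p) * ?y"
    "(?q * ?y - ?p * ?z) * ?b + (?a * ?z - ?b * ?y) * ?q = (?a * ?q - ?b * ?p) * ?z"
    by (simp_all add: algebra_simps)
  then have "scale ((?q * ?y - ?p * ?z) * ?a + (?a * ?z - ?b * ?y) * ?p) (u (Inl i))
      + scale ((?q * ?y - ?p * ?z) * ?b + (?a * ?z - ?b * ?y) * ?q) (u (Inr i))
    = scale ?y (u (Inl i)) + scale ?z (u (Inr i))"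
    using det_rat[OF assms] by simp
  then show ?thesis
    using assms by (simp add: new_basis_def new_coord_def scale_right_distrib scale_left_distrib ac_simps)
qed

text \<open>The selected index set contains both members of a pair or neither, so the basis chosen
  within pairs does not matter. This carries stability from \<open>Y\<close> back to the old
  coordinates.\<close>

lemma new_proj:
  "new.proj {k \<in> Inl ` S \<union> Inr ` D. case_sum id id k \<in> K} = proj {k \<in> Inl ` S \<union> Inr ` D. case_sum id id k \<in> K}"
proof
  fix x
  let ?I = "{k \<in> Inl ` S \<union> Inr ` D. case_sum id id k \<in> K}"
  have fin: "finite S" "finite D"
    using finite_index by (auto simp: finite_image_iff)
  have split: "sum g ?I = (\<Sum>i\<in>D \<inter> K. g (Inl i) + g (Inr i)) + (\<Sum>i\<in>(S - D) \<inter> K. g (Inl i))"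
    for g :: "'k + 'k \<Rightarrow> 'v"
  proof -
    have "?I = (Inl ` (D \<inter> K) \<union> Inr ` (D \<inter> K)) \<union> Inl ` ((S - D) \<inter> K)" using D by auto
    also have "sum g \<dots> = (sum g (Inl ` (D \<inter> K)) + sum g (Inr ` (D \<inter> K))) + sum g (Inl ` ((S - D) \<inter> K))"
      using fin by (subst sum.union_disjoint) (auto intro!: sum.union_disjoint)
    also have "\<dots> = (\<Sum>i\<in>D \<inter> K. g (Inl i) + g (Inr i)) + (\<Sum>i\<in>(S - D) \<inter> K. g (Inl i))"
      by (simp add: sum.reindex sum.distrib)
    finally show ?thesis .
  qed
  have "(\<Sum>i\<in>(S - D) \<inter> K. scale (new_coord (Inl i) x) (new_basis (Inl i)))
      = (\<Sum>i\<in>(S - D) \<inter> K. scale (c (Inl i) x) (u (Inl i)))"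
    by (intro sum.cong) (auto simp: new_coord_def new_basis_def)
  moreover have "(\<Sum>i\<in>D \<inter> K. scale (new_coord (Inl i) x) (new_basis (Inl i))
        + scale (new_coord (Inr i) x) (new_basis (Inr i)))
      = (\<Sum>i\<in>D \<inter> K. scale (c (Inl i) x) (u (Inl i)) + scale (c (Inr i) x) (u (Inr i)))"
    by (intro sum.cong new_pair) auto
  ultimately show "new.proj ?I x = proj ?I x"
    by (simp only: new.proj_def proj_def split)
qed

text \<open>Both members of a pair have the coefficient group \<open>\<tau> i\<close>, and the
  matrix and its inverse have integer entries.\<close>

lemma new_lattice:
  assumes T: "\<And>i. i \<in> S \<Longrightarrow> rational_group (\<tau> i)"
  shows "new.lattice (\<tau> \<circ> case_sum id id) = lattice (\<tau> \<circ> case_sum id id)"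
proof -
  have int: "of_int k * y - of_int l * z \<in> \<tau> i" if "i \<in> S" "y \<in> \<tau> i" "z \<in> \<tau> i" for i y z k l
    using T[OF that(1)] that rational_group_int_multiple[of "\<tau> i"]
    by (simp add: add_subgroup_diff rational_group_def)
  \<comment> \<open>The signs \<open>- p i\<close> and \<open>- b i\<close> give the right-hand
    sides the shape that \<open>int\<close> expects.\<close>
  have eq: "c (Inl i) x = of_int (a i) * new_coord (Inl i) x - of_int (- p i) * new_coord (Inr i) x"
    "c (Inr i) x = of_int (q i) * new_coord (Inr i) x - of_int (- b i) * new_coord (Inl i) x"
    if "i \<in> D" for i x
  proof -
    let ?a = "of_int (a i) :: rat" and ?b = "of_int (b i) :: rat"
      and ?p = "of_int (p i) :: rat" and ?q = "of_int (q i) :: rat"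
    let ?y = "c (Inl i) x" and ?z = "c (Inr i) x"
    have "?a * (?q * ?y - ?p * ?z) - (- ?p) * (?a * ?z - ?b * ?y) = (?a * ?q - ?b * ?p) * ?y"
      "?q * (?a * ?z - ?b * ?y) - (- ?b) * (?q * ?y - ?p * ?z) = (?a * ?q - ?b * ?p) * ?z"
      by (simp_all add: algebra_simps)
    then show "?y = ?a * new_coord (Inl i) x - of_int (- p i) * new_coord (Inr i) x"
      "?z = ?q * new_coord (Inr i) x - of_int (- b i) * new_coord (Inl i) x"
      using det_rat[OF that] that by (simp_all add: new_coord_def)
  qed
  \<comment> \<open>Selecting every label gives the full projections.\<close>
  have "new.proj (Inl ` S \<union> Inr ` D) = proj (Inl ` S \<union> Inr ` D)"
    using new_proj[of UNIV] by (simp only: UNIV_I simp_thms Collect_mem_eq)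
  moreover have "(\<forall>k\<in>Inl ` S \<union> Inr ` D. new_coord k x \<in> (\<tau> \<circ> case_sum id id) k)
    \<longleftrightarrow> (\<forall>k\<in>Inl ` S \<union> Inr ` D. c k x \<in> (\<tau> \<circ> case_sum id id) k)" (is "?l \<longleftrightarrow> ?r") for x
  proof
    assume l: ?l
    have "c (Inl i) x \<in> \<tau> i" "c (Inr i) x \<in> \<tau> i" if i: "i \<in> D" for i
    proof -
      have "new_coord (Inl i) x \<in> \<tau> i" "new_coord (Inr i) x \<in> \<tau> i" "i \<in> S"
        using bspec[OF l, of "Inl i"] bspec[OF l, of "Inr i"] i D by auto
      then show "c (Inl i) x \<in> \<tau> i" "c (Inr i) x \<in> \<tau> i"
        unfolding eq[OF i] by (simp_all only: int)
    qed
    moreover have "c (Inl i) x \<in> \<tau> i" if "i \<in> S - D" for i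
      using bspec[OF l, of "Inl i"] that by (auto simp: new_coord_def)
    ultimately show ?r by fastforce
  next
    assume r: ?r
    have "c (Inl i) x \<in> \<tau> i" if "i \<in> S" for i
      using bspec[OF r, of "Inl i"] that by simp
    moreover have "c (Inr i) x \<in> \<tau> i" if "i \<in> D" for i
      using bspec[OF r, of "Inr i"] that by simp
    ultimately show ?l using D by (auto simp: new_coord_def int subset_iff)
  qed
  ultimately show ?thesis
    by (intro set_eqI) (simp only: new.mem_lattice_iff mem_lattice_iff)
qed

end

section \<open>Splitting \<open>X\<^sub>1 + X\<^sub>2\<close> with \<open>Y\<close> as a
  summand\<close>

theorem lemma6p7:
  fixes scale :: "rat \<Rightarrow> 'v::ab_group_add \<Rightarrow> 'v"
    and d r s :: nat
    and \<tau> :: "nat \<Rightarrow> rat set"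
    and v w :: "nat \<Rightarrow> 'v"
    and A\<^sub>1 A\<^sub>2 X\<^sub>1 X\<^sub>2 :: "'v set"
    and e\<^sub>1 e\<^sub>2 :: int
    and \<alpha> \<beta> f :: "nat \<Rightarrow> int"
  assumes "vector_space scale"
    and "1 \<le> d" and "d \<le> r" and "r \<le> s"
    and "\<forall>i\<in>{1..s}. rational_group (\<tau> i)"
    and "\<forall>i\<in>{1..s}. \<forall>j\<in>{1..s}. i \<noteq> j \<longrightarrow> \<not> type_le (\<tau> i) (\<tau> j)"
    and "\<forall>i\<in>{1..s}. v i \<noteq> 0" and "\<forall>i\<in>{1..d}. w i \<noteq> 0"
    and "internal_direct_sum A\<^sub>1 {1..r} (\<lambda>i. rat_multiples scale (\<tau> i) (v i))"
    and "internal_direct_sum A\<^sub>2 ({1..d} \<union> {r+1..s})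
           (\<lambda>i. rat_multiples scale (\<tau> i) (if i \<le> d then w i else v i))"
    and "0 < e\<^sub>1" and "0 < e\<^sub>2" and "coprime e\<^sub>1 e\<^sub>2"
    and "\<forall>i\<in>{1..r}. \<alpha> i dvd e\<^sub>1"
    and "\<forall>i\<in>{1..d} \<union> {r+1..s}. \<beta> i dvd e\<^sub>2"
    and "X\<^sub>1 = A\<^sub>1 + int_multiples_over scale e\<^sub>1 (\<Sum>i=1..r. scale (of_int (\<alpha> i)) (v i))"
    and "X\<^sub>2 = A\<^sub>2 + int_multiples_over scale e\<^sub>2
           ((\<Sum>i=1..d. scale (of_int (\<beta> i)) (w i)) + (\<Sum>i=r+1..s. scale (of_int (\<beta> i)) (v i)))"
    and "A\<^sub>1 = regulator scale X\<^sub>1" and "A\<^sub>2 = regulator scale X\<^sub>2"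
    and "X\<^sub>1 \<inter> X\<^sub>2 = {0}"
    and "\<forall>i\<in>{1..d}. f i = gcd (e\<^sub>2 * \<alpha> i) (e\<^sub>1 * \<beta> i)"
  shows "A\<^sub>1 + A\<^sub>2 = regulator scale (X\<^sub>1 + X\<^sub>2) \<and>
    (\<exists>v' w' A Y.
       decomposition_basis scale (A\<^sub>1 + A\<^sub>2) (v' ` {1..d} \<union> w' ` {1..d} \<union> v ` {d+1..s}) \<and>
       (\<forall>i\<in>{1..d}. {x. scale x (v' i) \<in> A\<^sub>1 + A\<^sub>2} = \<tau> i \<and>
                    {x. scale x (w' i) \<in> A\<^sub>1 + A\<^sub>2} = \<tau> i) \<and>
       internal_direct_sum A {1..s}
         (\<lambda>i. rat_multiples scale (\<tau> i) (if i \<le> d then v' i else v i)) \<and>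
       Y = A + int_multiples_over scale (e\<^sub>1 * e\<^sub>2)
             ((\<Sum>i=1..d. scale (of_int (f i)) (v' i))
              + (\<Sum>i=d+1..r. scale (of_int (e\<^sub>2 * \<alpha> i)) (v i))
              + (\<Sum>i=r+1..s. scale (of_int (e\<^sub>1 * \<beta> i)) (v i))) \<and>
       internal_direct_sum (X\<^sub>1 + X\<^sub>2) {0..d}
         (\<lambda>i. if i = 0 then Y else rat_multiples scale (\<tau> i) (w' i)) \<and>
       (indecomposable X\<^sub>1 \<and> indecomposable X\<^sub>2 \<longrightarrow> indecomposable Y) \<and>
       (\<forall>i\<in>{1..d}. f i dvd e\<^sub>1 * e\<^sub>2) \<and>
       (\<forall>i\<in>{d+1..r}. e\<^sub>2 * \<alpha> i dvd e\<^sub>1 * e\<^sub>2) \<and>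
       (\<forall>i\<in>{r+1..s}. e\<^sub>1 * \<beta> i dvd e\<^sub>1 * e\<^sub>2) \<and>
       card ({X\<^sub>1, X\<^sub>2} - {{0}})
         \<le> card (insert Y ((\<lambda>i. rat_multiples scale (\<tau> i) (w' i)) ` {1..d}) - {{0}}))"
proof -
  note d = assms(2-4) and e = assms(11-13) and \<tau> = assms(5)[rule_format]
    and inc = assms(6)[rule_format] and X\<^sub>1_def = assms(16) and X\<^sub>2_def = assms(17)
  note One_nat_def [simp del]
  interpret rat_vector_space scale using assms(1) by (simp add: rat_vector_space_def)
  define a\<^sub>1 where "a\<^sub>1 = (\<Sum>i=1..r. scale (of_int (\<alpha> i)) (v i))"
  define a\<^sub>2 where
    "a\<^sub>2 = (\<Sum>i=1..d. scale (of_int (\<beta> i)) (w i)) + (\<Sum>i=r+1..s. scale (of_int (\<beta> i)) (v i))"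
  \<comment> \<open>\<open>Inl i\<close> stands for \<open>v i\<close> and \<open>Inr i\<close> for
    \<open>w i\<close>; \<open>b\<close> forgets the copy, so common types get equal labels.
    \<open>J\<close>, with one copy of each type, will index the summands of
    \<open>A\<close>.\<close>
  define I\<^sub>1 I\<^sub>2 :: "(nat + nat) set"
    where "I\<^sub>1 = Inl ` {1..r}" and "I\<^sub>2 = Inr ` {1..d} \<union> Inl ` {r+1..s}"
  define J :: "(nat + nat) set" where "J = Inl ` {1..s}"
  define u where "u = case_sum v w"
  define b :: "nat + nat \<Rightarrow> nat" where "b = case_sum id id"
  define T where "T = \<tau> \<circ> b"
  let ?G = "\<lambda>k. rat_multiples scale (T k) (u k)"
  have I: "I\<^sub>1 \<union> I\<^sub>2 = Inl ` {1..s} \<union> Inr ` {1..d}"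
  proof -
    have "{1..s} = {1..r} \<union> {r+1..s}" using d by auto
    then show ?thesis unfolding I\<^sub>1_def I\<^sub>2_def by (auto simp only: image_Un)
  qed
  have disj: "I\<^sub>1 \<inter> I\<^sub>2 = {}" by (auto simp: I\<^sub>1_def I\<^sub>2_def)
  have JI: "J \<subseteq> I\<^sub>1 \<union> I\<^sub>2" unfolding I J_def by auto
  have b_mem: "b k \<in> {1..s}" if "k \<in> I\<^sub>1 \<union> I\<^sub>2" for k
    using that d unfolding I by (auto simp: b_def)
  have T: "rational_group (T k)" if "k \<in> I\<^sub>1 \<union> I\<^sub>2" for k
    using \<tau>[OF b_mem[OF that]] by (simp add: T_def)
  have T_inc: "\<not> type_le (T k) (T l)" if "k \<in> I\<^sub>1 \<union> I\<^sub>2" "l \<in> I\<^sub>1 \<union> I\<^sub>2" "b k \<noteq> b l" for k l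
    using inc[OF b_mem[OF that(1)] b_mem[OF that(2)] that(3)] by (simp add: T_def)
  \<comment> \<open>No type repeats within any one of these index sets, although labels repeat on
    \<open>I\<^sub>1 \<union> I\<^sub>2\<close>.\<close>
  have inj: "inj_on b I\<^sub>1" "inj_on b I\<^sub>2" "inj_on b J"
    using d by (auto simp: inj_on_def b_def I\<^sub>1_def I\<^sub>2_def J_def)

  have ids\<^sub>1: "internal_direct_sum A\<^sub>1 I\<^sub>1 ?G"
    unfolding I\<^sub>1_def using assms(9)
    by (subst internal_direct_sum_reindex) (auto simp: o_def T_def b_def u_def)
  have ids\<^sub>2: "internal_direct_sum A\<^sub>2 I\<^sub>2 ?G"
  proof -
    let ?f = "\<lambda>i. if i \<le> d then Inr i else Inl i"
    have "I\<^sub>2 = ?f ` ({1..d} \<union> {r+1..s})"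
      using d unfolding I\<^sub>2_def image_Un by (intro arg_cong2[of _ _ _ _ "(\<union>)"] image_cong) auto
    moreover have "inj_on ?f ({1..d} \<union> {r+1..s})" by (auto simp: inj_on_def)
    moreover have "internal_direct_sum A\<^sub>2 ({1..d} \<union> {r+1..s}) (?G \<circ> ?f)"
      using assms(10) by (rule internal_direct_sum_cong) (auto simp: T_def b_def u_def)
    ultimately show ?thesis by (simp only: internal_direct_sum_reindex)
  qed
  have A_sub: "add_subgroup A\<^sub>1" "add_subgroup A\<^sub>2"
    using ids\<^sub>1 ids\<^sub>2 by (auto intro: internal_direct_sum_subgroup)
  have "A\<^sub>1 \<subseteq> X\<^sub>1" "A\<^sub>2 \<subseteq> X\<^sub>2"
    unfolding X\<^sub>1_def X\<^sub>2_def
    using set_zero_plus2[OF add_subgroup_zero[OF add_subgroup_int_multiples_over]]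
    by (metis add.commute)+
  then have "A\<^sub>1 \<inter> A\<^sub>2 = {0}"
    using assms(20) A_sub add_subgroup_zero by blast
  with ids\<^sub>1 ids\<^sub>2 disj have ids: "internal_direct_sum (A\<^sub>1 + A\<^sub>2) (I\<^sub>1 \<union> I\<^sub>2) ?G"
    by (rule internal_direct_sum_Un)
  have u_nz: "u k \<noteq> 0" if "k \<in> I\<^sub>1 \<union> I\<^sub>2" for k
    using that assms(7,8) unfolding I by (auto simp: u_def)
  have "finite (I\<^sub>1 \<union> I\<^sub>2)" by (simp add: I)
  then obtain c where "coordinate_frame scale (I\<^sub>1 \<union> I\<^sub>2) u c"
    using direct_sum_independent[OF ids T u_nz] by (rule coordinate_frame_exists)
  then interpret F: coordinate_frame scale "I\<^sub>1 \<union> I\<^sub>2" u c .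
  interpret F\<^sub>1: coordinate_frame scale I\<^sub>1 u c by (rule F.coordinate_frame_subset) simp
  interpret F\<^sub>2: coordinate_frame scale I\<^sub>2 u c by (rule F.coordinate_frame_subset) simp
  have A\<^sub>1: "A\<^sub>1 = F\<^sub>1.lattice T" and A\<^sub>2: "A\<^sub>2 = F\<^sub>2.lattice T" and A\<^sub>1\<^sub>2: "A\<^sub>1 + A\<^sub>2 = F.lattice T"
    using ids\<^sub>1 ids\<^sub>2 ids
    by (auto simp: F.lattice_def F\<^sub>1.lattice_def F\<^sub>2.lattice_def internal_direct_sum_def)
  have "a\<^sub>1 = (\<Sum>k\<in>I\<^sub>1. scale (of_int (\<alpha> (b k))) (u k))"
    by (simp add: a\<^sub>1_def I\<^sub>1_def sum.reindex u_def b_def)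
  then have a\<^sub>1: "a\<^sub>1 \<in> A\<^sub>1" using T F\<^sub>1.int_combination_mem_lattice by (simp add: A\<^sub>1)
  have "(\<Sum>k\<in>I\<^sub>2. scale (of_int (\<beta> (b k))) (u k))
      = (\<Sum>k\<in>Inr ` {1..d}. scale (of_int (\<beta> (b k))) (u k))
        + (\<Sum>k\<in>Inl ` {r+1..s}. scale (of_int (\<beta> (b k))) (u k))"
    unfolding I\<^sub>2_def by (rule sum.union_disjoint) auto
  then have "a\<^sub>2 = (\<Sum>k\<in>I\<^sub>2. scale (of_int (\<beta> (b k))) (u k))"
    by (simp add: a\<^sub>2_def sum.reindex u_def b_def)
  then have a\<^sub>2: "a\<^sub>2 \<in> A\<^sub>2" using T F\<^sub>2.int_combination_mem_lattice by (simp add: A\<^sub>2)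

  have X\<^sub>1: "X\<^sub>1 = F\<^sub>1.lattice T + int_multiples_over scale e\<^sub>1 a\<^sub>1"
    and X\<^sub>2: "X\<^sub>2 = F\<^sub>2.lattice T + int_multiples_over scale e\<^sub>2 a\<^sub>2"
    using X\<^sub>1_def X\<^sub>2_def A\<^sub>1 A\<^sub>2 by (simp_all only: a\<^sub>1_def a\<^sub>2_def)
  have acd\<^sub>1: "acd_frame scale I\<^sub>1 u c T b X\<^sub>1 e\<^sub>1"
    unfolding X\<^sub>1 using T T_inc e a\<^sub>1 A\<^sub>1 by (intro F\<^sub>1.acd_frame_cyclic_extension) auto
  have acd\<^sub>2: "acd_frame scale I\<^sub>2 u c T b X\<^sub>2 e\<^sub>2"
    unfolding X\<^sub>2 using T T_inc e a\<^sub>2 A\<^sub>2 by (intro F\<^sub>2.acd_frame_cyclic_extension) auto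
  interpret P: acd_frame_pair scale I\<^sub>1 I\<^sub>2 u c T b X\<^sub>1 e\<^sub>1 X\<^sub>2 e\<^sub>2
    using acd\<^sub>1 acd\<^sub>2 F.coordinate_frame_axioms disj
    by (auto simp: acd_frame_pair_def acd_frame_pair_axioms_def)
  interpret P': acd_frame_pair scale I\<^sub>2 I\<^sub>1 u c T b X\<^sub>2 e\<^sub>2 X\<^sub>1 e\<^sub>1
    by (rule P.swap)

  define g where "g = scale (of_int e\<^sub>2) a\<^sub>1 + scale (of_int e\<^sub>1) a\<^sub>2"
  have X: "X\<^sub>1 + X\<^sub>2 = F.lattice T + int_multiples_over scale (e\<^sub>1 * e\<^sub>2) g"
    unfolding X\<^sub>1_def X\<^sub>2_def A\<^sub>1\<^sub>2[symmetric] g_def a\<^sub>1_def[symmetric] a\<^sub>2_def[symmetric]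
    using A_sub a\<^sub>1 a\<^sub>2 e by (rule cyclic_extensions_sum)
  have e12: "e\<^sub>1 * e\<^sub>2 > 0" using e by simp
  have g: "g \<in> F.lattice T"
    unfolding g_def A\<^sub>1\<^sub>2[symmetric] using A_sub a\<^sub>1 a\<^sub>2 by (intro set_plus_intro subgroup_int_multiple)
  have acd: "acd_frame scale (I\<^sub>1 \<union> I\<^sub>2) u c T b (X\<^sub>1 + X\<^sub>2) (e\<^sub>1 * e\<^sub>2)"
    unfolding X using T T_inc g e12 by (intro F.acd_frame_cyclic_extension) auto
  have fin: "finite (cosets (X\<^sub>1 + X\<^sub>2) (F.lattice T))"
    unfolding X using internal_direct_sum_subgroup[OF ids] g e12
    by (intro cyclic_extension_finite_index) (simp_all only: A\<^sub>1\<^sub>2)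
  have "finite (cosets X\<^sub>1 (F\<^sub>1.lattice T))" "finite (cosets X\<^sub>2 (F\<^sub>2.lattice T))"
    unfolding X\<^sub>1 X\<^sub>2 using A_sub a\<^sub>1 a\<^sub>2 e by (auto simp: A\<^sub>1 A\<^sub>2 intro: cyclic_extension_finite_index)
  \<comment> \<open>Here the hypotheses on the regulators of \<open>X\<^sub>1\<close> and
    \<open>X\<^sub>2\<close> enter: each block lies in the regulator, which is the lattice.\<close>
  then have "P.F\<^sub>1.block k \<subseteq> F\<^sub>1.lattice T" "P.F\<^sub>2.block k \<subseteq> F\<^sub>2.lattice T" for k
    using P.F\<^sub>1.block_le_regulator[OF _ inj(1)] P.F\<^sub>2.block_le_regulator[OF _ inj(2)] assms(18,19) A\<^sub>1 A\<^sub>2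
    by metis+
  then have reg: "regulator scale (X\<^sub>1 + X\<^sub>2) = A\<^sub>1 + A\<^sub>2"
    unfolding A\<^sub>1\<^sub>2 by (rule P.regulator_sum[OF acd fin])

  have \<alpha>_dvd: "\<And>i. i \<in> {1..r} \<Longrightarrow> \<alpha> i dvd e\<^sub>1" and \<beta>_dvd: "\<And>i. i \<in> {1..d} \<union> {r+1..s} \<Longrightarrow> \<beta> i dvd e\<^sub>2"
    and f: "\<And>i. i \<in> {1..d} \<Longrightarrow> f i = gcd (e\<^sub>2 * \<alpha> i) (e\<^sub>1 * \<beta> i)"
    using assms(14,15,21) by blast+
  have "\<exists>a b' p q. e\<^sub>2 * \<alpha> i = f i * a \<and> e\<^sub>1 * \<beta> i = f i * b' \<and> a * q - b' * p = 1" if i: "i \<in> {1..d}" for i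
  proof -
    \<comment> \<open>A divisor of the positive number \<open>e\<^sub>1\<close> is nonzero, so
      \<open>f i\<close> can be cancelled from the Bezout identity.\<close>
    have "\<alpha> i \<noteq> 0" using \<alpha>_dvd[of i] i d e by auto
    then have f0: "f i \<noteq> 0" using f[OF i] e by simp
    obtain a b' where ab: "e\<^sub>2 * \<alpha> i = f i * a" "e\<^sub>1 * \<beta> i = f i * b'"
      using f[OF i] by (metis dvdE gcd_dvd1 gcd_dvd2)
    obtain q p where "q * (e\<^sub>2 * \<alpha> i) + p * (e\<^sub>1 * \<beta> i) = f i"
      using f[OF i] by (metis bezout_int)
    \<comment> \<open>The sign of \<open>p\<close> is changed to fit the determinant
      convention.\<close>
    then have "f i * (a * q - b' * (- p)) = f i * 1" unfolding ab by (simp add: algebra_simps)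
    then have "a * q - b' * (- p) = 1" using f0 by (metis mult_left_cancel)
    then show ?thesis using ab by blast
  qed
  then obtain m n p q where mn: "\<And>i. i \<in> {1..d} \<Longrightarrow> e\<^sub>2 * \<alpha> i = f i * m i"
    "\<And>i. i \<in> {1..d} \<Longrightarrow> e\<^sub>1 * \<beta> i = f i * n i" and det: "\<And>i. i \<in> {1..d} \<Longrightarrow> m i * q i - n i * p i = 1"
    by metis
  \<comment> \<open>The matrix row \<open>(m i, n i)\<close> produces \<open>v' i\<close>, the row
    \<open>(p i, q i)\<close> produces \<open>w' i\<close>.\<close>
  interpret U: unimodular_change scale "{1..s}" "{1..d}" u c m n p q
    using F.coordinate_frame_axioms d det
    by (auto simp: I unimodular_change_def unimodular_change_axioms_def)
  define v' w' where "v' i = U.new_basis (Inl i)" and "w' i = U.new_basis (Inr i)" for i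
  have v'_old: "v' i = v i" if "i \<notin> {1..d}" for i
    unfolding v'_def U.new_basis_def unfolding u_def using that by auto
  have v': "v' i = (if i \<le> d then v' i else v i)" if "i \<in> {1..s}" for i
    using that v'_old by auto
  \<comment> \<open>This removes the second vector of each pair: in the \<open>i\<close>-th block,
    \<open>g\<close> is a multiple of \<open>v' i\<close> alone.\<close>
  have fv': "scale (of_int (f i)) (v' i) = scale (of_int (e\<^sub>2 * \<alpha> i)) (v i) + scale (of_int (e\<^sub>1 * \<beta> i)) (w i)"
    if "i \<in> {1..d}" for i
    unfolding mn[OF that] v'_def U.new_basis_def unfolding u_def
    using that by (simp add: scale_right_distrib)
  have L: "U.new.lattice T = A\<^sub>1 + A\<^sub>2"
    unfolding A\<^sub>1\<^sub>2 I T_def b_def using \<tau> by (rule U.new_lattice)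
  interpret Y: coordinate_frame scale J U.new_basis U.new_coord
    by (rule U.new.coordinate_frame_subset) (simp add: J_def)
  define A where "A = Y.lattice T"
  define Y where "Y = A + int_multiples_over scale (e\<^sub>1 * e\<^sub>2) g"
  have g_eq: "g = (\<Sum>i=1..d. scale (of_int (f i)) (v' i))
              + (\<Sum>i=d+1..r. scale (of_int (e\<^sub>2 * \<alpha> i)) (v i))
              + (\<Sum>i=r+1..s. scale (of_int (e\<^sub>1 * \<beta> i)) (v i))"
  proof -
    have "{1..r} = {1..d} \<union> {d+1..r}" using d by auto
    then have "(\<Sum>i=1..r. scale (of_int (\<alpha> i)) (v i))
        = (\<Sum>i=1..d. scale (of_int (\<alpha> i)) (v i)) + (\<Sum>i=d+1..r. scale (of_int (\<alpha> i)) (v i))"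
      by (simp only:) (rule sum.union_disjoint, auto)
    then show ?thesis
      by (simp add: g_def a\<^sub>1_def a\<^sub>2_def fv' scale_right_distrib scale_sum_right sum.distrib ac_simps)
  qed
  \<comment> \<open>Since \<open>g\<close> has no \<open>w'\<close> component, it lies in
    \<open>A\<close>, and \<open>Y\<close> is a cyclic extension of \<open>A\<close>.\<close>
  have g_A: "g \<in> A"
  proof -
    let ?k = "\<lambda>k. if b k \<le> d then f (b k) else if b k \<le> r then e\<^sub>2 * \<alpha> (b k) else e\<^sub>1 * \<beta> (b k)"
    let ?h = "\<lambda>i. scale (of_int (?k (Inl i))) (v' i)"
    have "{1..s} = {1..d} \<union> {d+1..r} \<union> {r+1..s}" using d by auto
    then have "sum ?h {1..s} = sum ?h {1..d} + sum ?h {d+1..r} + sum ?h {r+1..s}"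
      using d by (simp only:) (subst sum.union_disjoint, auto intro!: sum.union_disjoint)
    also have "\<dots> = g"
      unfolding g_eq using d by (intro arg_cong2[of _ _ _ _ "(+)"] sum.cong) (auto simp: b_def v'_old)
    finally have "g = (\<Sum>k\<in>J. scale (of_int (?k k)) (U.new_basis k))"
      by (simp add: J_def sum.reindex v'_def)
    also have "\<dots> \<in> A" unfolding A_def using T JI by (intro Y.int_combination_mem_lattice) auto
    finally show ?thesis .
  qed
  have acdY: "acd_frame scale J U.new_basis U.new_coord T b Y (e\<^sub>1 * e\<^sub>2)"
    unfolding Y_def A_def using T T_inc JI g_A e12
    by (intro Y.acd_frame_cyclic_extension) (auto simp: A_def)
  interpret Y: acd_frame scale J U.new_basis U.new_coord T b Y "e\<^sub>1 * e\<^sub>2" by (rule acdY)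

  let ?W = "\<lambda>i. rat_multiples scale (\<tau> i) (w' i)"
  have idsA: "internal_direct_sum A {1..s} (\<lambda>i. rat_multiples scale (\<tau> i) (if i \<le> d then v' i else v i))"
  proof -
    have "internal_direct_sum A J (\<lambda>k. rat_multiples scale (T k) (U.new_basis k))"
      unfolding A_def using T JI by (intro Y.internal_direct_sum_lattice) (auto simp: rational_group_def)
    then have "internal_direct_sum A {1..s} ((\<lambda>k. rat_multiples scale (T k) (U.new_basis k)) \<circ> Inl)"
      unfolding J_def by (subst (asm) internal_direct_sum_reindex) auto
    then show ?thesis
    proof (rule internal_direct_sum_cong)
      fix i assume "i \<in> {1..s}"
      from v'[OF this] show "((\<lambda>k. rat_multiples scale (T k) (U.new_basis k)) \<circ> Inl) i
        = rat_multiples scale (\<tau> i) (if i \<le> d then v' i else v i)"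
        by (simp add: T_def b_def v'_def)
    qed
  qed
  have LAW: "A\<^sub>1 + A\<^sub>2 = A + (\<Sum>i=1..d. ?W i)"
  proof -
    have "A\<^sub>1 + A\<^sub>2 = (\<Sum>k\<in>Inl ` {1..s}. rat_multiples scale (T k) (U.new_basis k))
        + (\<Sum>k\<in>Inr ` {1..d}. rat_multiples scale (T k) (U.new_basis k))"
      unfolding L[symmetric] U.new.lattice_def by (rule sum.union_disjoint) auto
    also have "\<dots> = A + (\<Sum>i=1..d. ?W i)"
      unfolding A_def Y.lattice_def unfolding J_def by (simp add: sum.reindex T_def b_def w'_def)
    finally show ?thesis .
  qed
  \<comment> \<open>Members of \<open>Y\<close> lie in the span of the basis vectors indexed by
    \<open>J\<close>. This yields directness below and is reused for indecomposability.\<close>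
  have new_coord_Y: "U.new_coord (Inr i) y = 0" if "y \<in> Y" "i \<in> {1..d}" for y i
  proof -
    have "U.new_coord (Inr i) (Y.proj J y) = 0"
      using that by (subst U.new.coord_proj) (auto simp: J_def)
    then show ?thesis using Y.proj_index[OF that(1)] by simp
  qed
  have w'_coord: "U.new_coord (Inr i) (w' j) = (if i = j then 1 else 0)" if "i \<in> {1..d}" "j \<in> {1..d}" for i j
    using that U.new.coord_basis[of "Inr i" "Inr j"] by (simp add: w'_def)
  have idsX: "internal_direct_sum (X\<^sub>1 + X\<^sub>2) {0..d} (\<lambda>i. if i = 0 then Y else ?W i)"
    unfolding internal_direct_sum_def
  proof (intro conjI ballI allI impI)
    fix i assume "i \<in> {0..d}"
    then show "add_subgroup (if i = 0 then Y else ?W i)"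
      using Y.X \<tau>[of i] d by (auto simp: rational_group_def intro!: add_subgroup_rat_multiples)
  next
    have range: "{0..d} = insert 0 {1..d}" by auto
    have "(\<Sum>i\<in>{0..d}. if i = 0 then Y else ?W i) = Y + (\<Sum>i=1..d. if i = 0 then Y else ?W i)"
      unfolding range by (subst sum.insert) auto
    also have "(\<Sum>i=1..d. if i = 0 then Y else ?W i) = (\<Sum>i=1..d. ?W i)"
      by (intro sum.cong) auto
    \<comment> \<open>A mere regrouping of summands: the cyclic part is attached to
      \<open>A\<close>, and the \<open>w'\<close> part is left free.\<close>
    also have "Y + (\<Sum>i=1..d. ?W i) = X\<^sub>1 + X\<^sub>2"
      unfolding X A\<^sub>1\<^sub>2[symmetric] LAW Y_def by (simp only: ac_simps)
    finally show "X\<^sub>1 + X\<^sub>2 = (\<Sum>i\<in>{0..d}. if i = 0 then Y else ?W i)" by simp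
  next
    fix z i assume z: "(\<forall>i\<in>{0..d}. z i \<in> (if i = 0 then Y else ?W i)) \<and> sum z {0..d} = 0" and i: "i \<in> {0..d}"
    have range: "{0..d} = insert 0 {1..d}" by auto
    have zY: "z 0 \<in> Y" using bspec[OF conjunct1[OF z], of 0] by simp
    have "\<exists>t. z j = scale t (w' j)" if "j \<in> {1..d}" for j
      using bspec[OF conjunct1[OF z], of j] that by (auto simp: rat_multiples_def)
    then obtain t where t: "\<And>j. j \<in> {1..d} \<Longrightarrow> z j = scale (t j) (w' j)" by metis
    have sum: "z 0 + sum z {1..d} = 0" using z unfolding range by simp
    have t0: "t j = 0" if j: "j \<in> {1..d}" for j
    proof -
      have "0 = U.new_coord (Inr j) (z 0 + sum z {1..d})"
        using sum j U.new.coord_zero by simp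
      also have "\<dots> = (\<Sum>l=1..d. U.new_coord (Inr j) (z l))"
        using j zY new_coord_Y by (simp add: U.new.coord_add U.new.coord_sum)
      also have "\<dots> = (\<Sum>l=1..d. if l = j then t j else 0)"
        using j by (intro sum.cong) (auto simp: t U.new.coord_scale w'_coord)
      finally show ?thesis using j by simp
    qed
    then have "z j = 0" if "j \<in> {1..d}" for j using t that by simp
    moreover from this have "z 0 = 0" using sum by simp
    ultimately show "z i = 0" using i by (cases "i = 0") auto
  qed simp
  have stab: "{x. scale x (U.new_basis k) \<in> A\<^sub>1 + A\<^sub>2} = T k" if "k \<in> I\<^sub>1 \<union> I\<^sub>2" for k
    using that T U.new.basis_multiple_mem_lattice[of k T] unfolding L[symmetric] I by auto
  have basis: "decomposition_basis scale (A\<^sub>1 + A\<^sub>2) (v' ` {1..d} \<union> w' ` {1..d} \<union> v ` {d+1..s})"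
  proof -
    have "{1..s} = {1..d} \<union> {d+1..s}" using d by auto
    moreover have "v' ` {d+1..s} = v ` {d+1..s}" using v'_old by (intro image_cong) auto
    ultimately have img: "v' ` {1..d} \<union> w' ` {1..d} \<union> v ` {d+1..s} = U.new_basis ` (I\<^sub>1 \<union> I\<^sub>2)"
      unfolding I image_Un image_image v'_def[symmetric] w'_def[symmetric] by (simp only: image_Un ac_simps)
    have "internal_direct_sum (A\<^sub>1 + A\<^sub>2) (I\<^sub>1 \<union> I\<^sub>2) (\<lambda>k. rat_multiples scale (T k) (U.new_basis k))"
      unfolding L[symmetric] I
      using T I by (intro U.new.internal_direct_sum_lattice) (auto simp: rational_group_def)
    then have "internal_direct_sum (A\<^sub>1 + A\<^sub>2) (I\<^sub>1 \<union> I\<^sub>2)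
      ((\<lambda>x. rat_multiples scale {t. scale t x \<in> A\<^sub>1 + A\<^sub>2} x) \<circ> U.new_basis)"
      by (rule internal_direct_sum_cong) (simp add: stab)
    \<comment> \<open>\<open>decomposition_basis\<close> is indexed by the vectors themselves, hence
      the reindexing along an injective map.\<close>
    moreover have "inj_on U.new_basis (I\<^sub>1 \<union> I\<^sub>2)" unfolding I by (rule U.new.inj_on_basis)
    ultimately show ?thesis
      using U.new.basis_nonzero stab T unfolding img decomposition_basis_def
      by (auto simp: internal_direct_sum_reindex I)
  qed
  have indec: "indecomposable Y" if ind: "indecomposable X\<^sub>1" "indecomposable X\<^sub>2"
  proof (rule Y.indecomposable_if_proj[OF inj(3)])
    show "J \<noteq> {}" using d by (auto simp: J_def)
    fix K assume K: "K \<subseteq> J" and KY: "\<And>x. x \<in> Y \<Longrightarrow> Y.proj K x \<in> Y"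
    define K' where "K' = {i. Inl i \<in> K}"
    have K_eq: "K = Inl ` K'" and K': "K' \<subseteq> {1..s}"
      using K by (auto simp: K'_def J_def)
    \<comment> \<open>\<open>K\<close> is enlarged by the partners \<open>Inr i\<close>, so that
      whole pairs are selected and \<open>U.new_proj\<close> applies.\<close>
    let ?K = "{k \<in> I\<^sub>1 \<union> I\<^sub>2. b k \<in> K'}"
    have proj_eq: "F.proj ?K = U.new.proj ?K"
      unfolding I b_def by (rule U.new_proj[symmetric])
    have "F.proj ?K x \<in> X\<^sub>1 + X\<^sub>2" if x: "x \<in> X\<^sub>1 + X\<^sub>2" for x
    proof -
      \<comment> \<open>The fractions of \<open>g\<close> belong to \<open>Y\<close>, so stability
        need only be checked on \<open>Y\<close> and on the lattice.\<close>
      have "x \<in> Y + F.lattice T"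
      proof -
        have "0 \<in> A" using Y.add_subgroup_lattice[of T] T JI unfolding A_def by (intro add_subgroup_zero) auto
        then have "int_multiples_over scale (e\<^sub>1 * e\<^sub>2) g \<subseteq> Y"
          unfolding Y_def by (rule set_zero_plus2)
        from set_plus_mono2[OF this order_refl, of "F.lattice T"] show ?thesis
          using x unfolding X by (subst (asm) (2) add.commute) blast
      qed
      then obtain y z where yz: "y \<in> Y" "z \<in> F.lattice T" "x = y + z" by (auto elim!: set_plus_elim)
      \<comment> \<open>The added indices contribute nothing, as members of \<open>Y\<close> have
        zero coordinates there.\<close>
      have "U.new.proj ?K y = Y.proj K y"
      proof -
        have "K \<subseteq> ?K" using K JI by (auto simp: K_eq b_def)
        moreover have "U.new_coord k y = 0" if "k \<in> ?K - K" for k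
          using that new_coord_Y[OF yz(1)] unfolding I by (auto simp: K_eq b_def)
        ultimately show ?thesis
          unfolding Y.proj_def by (intro sum.mono_neutral_right) (auto simp: I)
      qed
      then have "F.proj ?K y \<in> Y" using KY[OF yz(1)] proj_eq by simp
      moreover have "F.proj ?K z \<in> F.lattice T"
        using yz(2) T by (intro F.proj_mem_lattice) auto
      moreover have "F.proj ?K x = F.proj ?K y + F.proj ?K z"
        unfolding yz(3) by (rule F.proj_add) auto
      moreover have "Y \<subseteq> X\<^sub>1 + X\<^sub>2"
      proof -
        have "0 \<in> (\<Sum>i=1..d. ?W i)"
          using \<tau> d by (intro add_subgroup_zero add_subgroup_set_sum add_subgroup_rat_multiples)
            (auto simp: rational_group_def)
        then have "A \<subseteq> A\<^sub>1 + A\<^sub>2" unfolding LAW using set_zero_plus2 by (metis add.commute)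
        then show ?thesis unfolding X Y_def A\<^sub>1\<^sub>2[symmetric] by (intro set_plus_mono2) auto
      qed
      moreover have "F.lattice T \<subseteq> X\<^sub>1 + X\<^sub>2" using acd by (rule acd_frame.lattice_le)
      moreover have "add_subgroup (X\<^sub>1 + X\<^sub>2)" using acd by (rule acd_frame.X)
      ultimately show ?thesis by (simp add: add_subgroup_add subset_iff)
    qed
    note stable = this
    have part\<^sub>1: "{k \<in> I\<^sub>1. b k \<in> K'} = {} \<or> {k \<in> I\<^sub>1. b k \<in> K'} = I\<^sub>1"
      using P.proj_summand[OF stable] by (intro P.F\<^sub>1.indecomposable_proj[OF ind(1)]) auto
    have part\<^sub>2: "{k \<in> I\<^sub>2. b k \<in> K'} = {} \<or> {k \<in> I\<^sub>2. b k \<in> K'} = I\<^sub>2"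
      using P'.proj_summand[of K'] stable
      by (intro P.F\<^sub>2.indecomposable_proj[OF ind(2)]) (auto simp: Un_commute add.commute)
    \<comment> \<open>Because \<open>d \<ge> 1\<close>, label 1 occurs in both groups and ties the
      two alternatives together.\<close>
    have one: "Inl 1 \<in> I\<^sub>1" "Inr 1 \<in> I\<^sub>2" "b (Inl 1) = 1" "b (Inr 1) = 1"
      using d by (auto simp: I\<^sub>1_def I\<^sub>2_def b_def)
    have "(\<forall>k\<in>I\<^sub>1 \<union> I\<^sub>2. b k \<in> K') \<or> (\<forall>k\<in>I\<^sub>1 \<union> I\<^sub>2. b k \<notin> K')"
    proof (cases "1 \<in> K'")
      case True
      then have "{k \<in> I\<^sub>1. b k \<in> K'} = I\<^sub>1" "{k \<in> I\<^sub>2. b k \<in> K'} = I\<^sub>2"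
        using part\<^sub>1 part\<^sub>2 one by auto
      then show ?thesis by blast
    next
      case False
      then have "Inl 1 \<notin> {k \<in> I\<^sub>1. b k \<in> K'}" "Inr 1 \<notin> {k \<in> I\<^sub>2. b k \<in> K'}"
        using one by auto
      then have "{k \<in> I\<^sub>1. b k \<in> K'} = {}" "{k \<in> I\<^sub>2. b k \<in> K'} = {}"
        using part\<^sub>1 part\<^sub>2 one(1,2) by metis+
      then show ?thesis by blast
    qed
    then have "(\<forall>i\<in>{1..s}. i \<in> K') \<or> (\<forall>i\<in>{1..s}. i \<notin> K')" unfolding I by (force simp: b_def)
    then show "K = {} \<or> K = J" using K' unfolding K_eq J_def by blast
  qed
  \<comment> \<open>Summands are counted as a set of nonzero subgroups, at most two of which are
    \<open>X\<^sub>1\<close> and \<open>X\<^sub>2\<close>. On the other side \<open>Y\<close> and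
    the summand of \<open>w' 1\<close> are nonzero, and they differ because \<open>w' 1\<close> is
    not in \<open>Y\<close>.\<close>
  have card: "card ({X\<^sub>1, X\<^sub>2} - {{0}}) \<le> card (insert Y (?W ` {1..d}) - {{0}})"
  proof -
    have w1: "w' 1 \<in> ?W 1"
      using \<tau>[of 1] d by (auto simp: rat_multiples_def rational_group_def intro!: image_eqI[of _ _ 1])
    have "U.new_coord (Inr 1) (w' 1) = 1" using d w'_coord[of 1 1] by simp
    then have "w' 1 \<notin> Y" "w' 1 \<noteq> 0"
      using new_coord_Y[of "w' 1" 1] U.new.coord_zero[of "Inr 1"] d by auto
    moreover have "Y \<noteq> {0}"
      using Y.basis_mem[of "Inl 1"] Y.basis_nonzero[of "Inl 1"] d by (auto simp: J_def)
    ultimately have "Y \<noteq> ?W 1" "{Y, ?W 1} \<subseteq> insert Y (?W ` {1..d}) - {{0}}"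
      using w1 d by auto
    then have "2 \<le> card (insert Y (?W ` {1..d}) - {{0}})"
      using card_mono[of "insert Y (?W ` {1..d}) - {{0}}" "{Y, ?W 1}"] by simp
    moreover have "card ({X\<^sub>1, X\<^sub>2} - {{0}}) \<le> card {X\<^sub>1, X\<^sub>2}" by (intro card_mono) auto
    moreover have "card {X\<^sub>1, X\<^sub>2} \<le> 2" by (simp add: card_insert_if)
    ultimately show ?thesis by linarith
  qed
  have stab': "{x. scale x (v' i) \<in> A\<^sub>1 + A\<^sub>2} = \<tau> i \<and> {x. scale x (w' i) \<in> A\<^sub>1 + A\<^sub>2} = \<tau> i"
    if "i \<in> {1..d}" for i
    using that d stab[of "Inl i"] stab[of "Inr i"] unfolding I v'_def w'_def by (auto simp: T_def b_def)
  have dvd: "f i dvd e\<^sub>1 * e\<^sub>2" if "i \<in> {1..d}" for i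
  proof -
    have "f i dvd e\<^sub>2 * \<alpha> i" using f[OF that] by simp
    also have "e\<^sub>2 * \<alpha> i dvd e\<^sub>2 * e\<^sub>1" using \<alpha>_dvd[of i] that d by (intro mult_dvd_mono) auto
    finally show ?thesis by (simp add: mult.commute)
  qed
  have dvd\<^sub>1: "e\<^sub>2 * \<alpha> i dvd e\<^sub>1 * e\<^sub>2" if "i \<in> {d+1..r}" for i
    using \<alpha>_dvd[of i] that by (subst mult.commute) (auto intro: mult_dvd_mono)
  have dvd\<^sub>2: "e\<^sub>1 * \<beta> i dvd e\<^sub>1 * e\<^sub>2" if "i \<in> {r+1..s}" for i
    using \<beta>_dvd[of i] that by (intro mult_dvd_mono) auto
  show ?thesis
  proof (rule conjI[OF reg[symmetric]], rule exI[of _ v'], rule exI[of _ w'], rule exI[of _ A],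
      rule exI[of _ Y], intro conjI)
    show "\<forall>i\<in>{1..d}. {x. scale x (v' i) \<in> A\<^sub>1 + A\<^sub>2} = \<tau> i \<and> {x. scale x (w' i) \<in> A\<^sub>1 + A\<^sub>2} = \<tau> i"
      using stab' by blast
    show "indecomposable X\<^sub>1 \<and> indecomposable X\<^sub>2 \<longrightarrow> indecomposable Y"
      using indec by blast
    show "\<forall>i\<in>{1..d}. f i dvd e\<^sub>1 * e\<^sub>2" using dvd by blast
    show "\<forall>i\<in>{d+1..r}. e\<^sub>2 * \<alpha> i dvd e\<^sub>1 * e\<^sub>2" using dvd\<^sub>1 by blast
    show "\<forall>i\<in>{r+1..s}. e\<^sub>1 * \<beta> i dvd e\<^sub>1 * e\<^sub>2" using dvd\<^sub>2 by blast
  qed (rule basis idsA Y_def[unfolded g_eq] idsX card)+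
qed

end
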